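(* Let $\mathcal{F}$ be a family of finite colored posets (including the empty poset), closed under isomorphism, disjoint unions and convex sub-posets. Let $\mathcal{H}_{\mathcal{F}}$ be the $\mathbb{Q}$-vector space of finitely supported functions on isomorphism classes of members of $\mathcal{F}$, with product $$(f\star g)([P])=\sum_{I\in J_P} f([I])\,g([P\setminus I])$$ and coproduct $\Delta(f)([M],[N])=f([M+N])$. Then $\mathcal{H}_{\mathcal{F}}$, graded by $\deg\delta_{[P]}=|P|$, is a graded connected co-commutative Hopf algebra, and $\mathcal{H}_{\mathcal{F}}\cong U(\mathfrak{n}_{\mathcal{F}})$, where $\mathfrak{n}_{\mathcal{F}}$, the Lie algebra of primitive elements of $\mathcal{H}_{\mathcal{F}}$ (with commutator bracket), equals $\operatorname{span}\{\delta_{[P]} : P\in\mathcal{F},\ P \text{ connected}\}$.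
   Context: A colored poset is a finite poset with a coloring map to a fixed finite set; isomorphisms preserve order and colors. $J_P$ denotes the set of order ideals of $P$ (subsets $L$ with $y\in L$, $x\le y\Rightarrow x\in L$). A sub-poset $Q\subset P$ is convex if $x\le z\le y$ with $x,y\in Q$ implies $z\in Q$. $P_1+P_2$ denotes disjoint union of posets. $\delta_{[P]}$ is the indicator function of the isomorphism class of $P$. A poset is connected if it is not a disjoint union of two non-empty posets. An element $x$ is primitive if $\Delta(x)=x\otimes 1+1\otimes x$, where $1=\delta_{[\emptyset]}$.
   Formalization: "Connected" is taken to mean non-empty and not a disjoint union of two non-empty posets; read literally, the empty poset would be connected, but its indicator function 1 is not primitive, so the description of the primitive elements would fail. *)

theory Defs
  imports Complex_Main
begin

record 'c cposet =
  carr :: "nat set"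
  lev  :: "nat \<Rightarrow> nat \<Rightarrow> bool"
  colr :: "nat \<Rightarrow> 'c"

definition wf_cposet :: "'c cposet \<Rightarrow> bool" where
  "wf_cposet P \<longleftrightarrow> finite (carr P)
     \<and> (\<forall>x y. lev P x y \<longrightarrow> x \<in> carr P \<and> y \<in> carr P)
     \<and> (\<forall>x\<in>carr P. lev P x x)
     \<and> (\<forall>x y. lev P x y \<and> lev P y x \<longrightarrow> x = y)
     \<and> (\<forall>x y z. lev P x y \<and> lev P y z \<longrightarrow> lev P x z)"

definition cposet_iso :: "'c cposet \<Rightarrow> 'c cposet \<Rightarrow> bool" where
  "cposet_iso P Q \<longleftrightarrow> (\<exists>h. bij_betw h (carr P) (carr Q)
     \<and> (\<forall>x\<in>carr P. \<forall>y\<in>carr P. lev Q (h x) (h y) \<longleftrightarrow> lev P x y)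
     \<and> (\<forall>x\<in>carr P. colr Q (h x) = colr P x))"

definition restr :: "'c cposet \<Rightarrow> nat set \<Rightarrow> 'c cposet" where
  "restr P S = \<lparr>carr = S, lev = (\<lambda>x y. x \<in> S \<and> y \<in> S \<and> lev P x y), colr = colr P\<rparr>"

definition order_ideals :: "'c cposet \<Rightarrow> nat set set" where
  "order_ideals P = {L. L \<subseteq> carr P \<and> (\<forall>y\<in>L. \<forall>x\<in>carr P. lev P x y \<longrightarrow> x \<in> L)}"

definition convex_sub :: "'c cposet \<Rightarrow> nat set \<Rightarrow> bool" where
  "convex_sub P S \<longleftrightarrow> S \<subseteq> carr P \<and>
     (\<forall>x\<in>S. \<forall>y\<in>S. \<forall>z\<in>carr P. lev P x z \<and> lev P z y \<longrightarrow> z \<in> S)"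

definition dunion :: "'c cposet \<Rightarrow> 'c cposet \<Rightarrow> 'c cposet" where
  "dunion P Q = \<lparr>carr = carr P \<union> carr Q,
     lev = (\<lambda>x y. (x \<in> carr P \<and> y \<in> carr P \<and> lev P x y) \<or> (x \<in> carr Q \<and> y \<in> carr Q \<and> lev Q x y)),
     colr = (\<lambda>x. if x \<in> carr P then colr P x else colr Q x)\<rparr>"

definition dsum :: "'c cposet \<Rightarrow> 'c cposet \<Rightarrow> 'c cposet" where
  "dsum P Q = \<lparr>carr = (\<lambda>x. 2*x) ` carr P \<union> (\<lambda>x. 2*x+1) ` carr Q,
     lev = (\<lambda>x y. (even x \<and> even y \<and> x div 2 \<in> carr P \<and> y div 2 \<in> carr P \<and> lev P (x div 2) (y div 2))
                \<or> (odd x \<and> odd y \<and> x div 2 \<in> carr Q \<and> y div 2 \<in> carr Q \<and> lev Q (x div 2) (y div 2))),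
     colr = (\<lambda>x. if even x then colr P (x div 2) else colr Q (x div 2))\<rparr>"

definition empty_cposet :: "'c cposet" where
  "empty_cposet = \<lparr>carr = {}, lev = (\<lambda>_ _. False), colr = (\<lambda>_. undefined)\<rparr>"

definition connected_cposet :: "'c cposet \<Rightarrow> bool" where
  "connected_cposet P \<longleftrightarrow> carr P \<noteq> {} \<and>
     \<not> (\<exists>A B. A \<noteq> {} \<and> B \<noteq> {} \<and> A \<inter> B = {} \<and> A \<union> B = carr P \<and>
            (\<forall>x\<in>A. \<forall>y\<in>B. \<not> lev P x y \<and> \<not> lev P y x))"

definition family_ok :: "'c cposet set \<Rightarrow> bool" where
  "family_ok F \<longleftrightarrow> (\<forall>P\<in>F. wf_cposet P)
     \<and> empty_cposet \<in> F
     \<and> (\<forall>P Q. P \<in> F \<and> wf_cposet Q \<and> cposet_iso P Q \<longrightarrow> Q \<in> F)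
     \<and> (\<forall>P\<in>F. \<forall>Q\<in>F. carr P \<inter> carr Q = {} \<longrightarrow> dunion P Q \<in> F)
     \<and> (\<forall>P\<in>F. \<forall>S. convex_sub P S \<longrightarrow> restr P S \<in> F)"

text \<open>A function on isomorphism classes of members of F is represented as an
  isomorphism-invariant function on members of F (zero outside F).\<close>

definition Hsp :: "'c cposet set \<Rightarrow> ('c cposet \<Rightarrow> rat) set" where
  "Hsp F = {f. (\<forall>P. P \<notin> F \<longrightarrow> f P = 0)
     \<and> (\<forall>P\<in>F. \<forall>Q\<in>F. cposet_iso P Q \<longrightarrow> f P = f Q)
     \<and> (\<exists>S. finite S \<and> S \<subseteq> F \<and> (\<forall>P. f P \<noteq> 0 \<longrightarrow> (\<exists>Q\<in>S. cposet_iso Q P)))}"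

text \<open>H_F \<otimes> H_F = finitely supported functions on pairs of isomorphism classes.\<close>
definition Hsp2 :: "'c cposet set \<Rightarrow> ('c cposet \<times> 'c cposet \<Rightarrow> rat) set" where
  "Hsp2 F = {G. (\<forall>M N. M \<notin> F \<or> N \<notin> F \<longrightarrow> G (M, N) = 0)
     \<and> (\<forall>M\<in>F. \<forall>N\<in>F. \<forall>M'\<in>F. \<forall>N'\<in>F. cposet_iso M M' \<and> cposet_iso N N' \<longrightarrow> G (M, N) = G (M', N'))
     \<and> (\<exists>S. finite S \<and> S \<subseteq> F \<times> F \<and>
          (\<forall>M N. G (M, N) \<noteq> 0 \<longrightarrow> (\<exists>(M', N')\<in>S. cposet_iso M' M \<and> cposet_iso N' N)))}"

definition fzero :: "'x \<Rightarrow> rat" where "fzero = (\<lambda>_. 0)"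
definition fadd :: "('x \<Rightarrow> rat) \<Rightarrow> ('x \<Rightarrow> rat) \<Rightarrow> 'x \<Rightarrow> rat" where
  "fadd f g = (\<lambda>x. f x + g x)"
definition fscale :: "rat \<Rightarrow> ('x \<Rightarrow> rat) \<Rightarrow> 'x \<Rightarrow> rat" where
  "fscale c f = (\<lambda>x. c * f x)"

definition delta :: "'c cposet set \<Rightarrow> 'c cposet \<Rightarrow> 'c cposet \<Rightarrow> rat" where
  "delta F P = (\<lambda>Q. if Q \<in> F \<and> cposet_iso P Q then 1 else 0)"

definition unitH :: "'c cposet set \<Rightarrow> 'c cposet \<Rightarrow> rat" where
  "unitH F = delta F empty_cposet"

definition unit2 :: "'c cposet set \<Rightarrow> 'c cposet \<times> 'c cposet \<Rightarrow> rat" where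
  "unit2 F = (\<lambda>(M, N). unitH F M * unitH F N)"

definition mult2 :: "'c cposet set \<Rightarrow> ('c cposet \<times> 'c cposet \<Rightarrow> rat) \<Rightarrow> 'c cposet \<Rightarrow> rat" where
  "mult2 F G = (\<lambda>P. if P \<in> F then (\<Sum>I\<in>order_ideals P. G (restr P I, restr P (carr P - I))) else 0)"

definition star :: "'c cposet set \<Rightarrow> ('c cposet \<Rightarrow> rat) \<Rightarrow> ('c cposet \<Rightarrow> rat) \<Rightarrow> 'c cposet \<Rightarrow> rat" where
  "star F f g = (\<lambda>P. if P \<in> F then
      (\<Sum>I\<in>order_ideals P. f (restr P I) * g (restr P (carr P - I))) else 0)"

text \<open>The product on H \<otimes> H: (a \<otimes> b)(c \<otimes> d) = ac \<otimes> bd.\<close>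
definition star2 :: "'c cposet set \<Rightarrow> ('c cposet \<times> 'c cposet \<Rightarrow> rat) \<Rightarrow> ('c cposet \<times> 'c cposet \<Rightarrow> rat)
                      \<Rightarrow> 'c cposet \<times> 'c cposet \<Rightarrow> rat" where
  "star2 F G K = (\<lambda>(M, N). if M \<in> F \<and> N \<in> F then
      (\<Sum>I\<in>order_ideals M. \<Sum>J\<in>order_ideals N.
          G (restr M I, restr N J) * K (restr M (carr M - I), restr N (carr N - J))) else 0)"

definition cop :: "'c cposet set \<Rightarrow> ('c cposet \<Rightarrow> rat) \<Rightarrow> 'c cposet \<times> 'c cposet \<Rightarrow> rat" where
  "cop F f = (\<lambda>(M, N). if M \<in> F \<and> N \<in> F then f (dsum M N) else 0)"

definition counit :: "('c cposet \<Rightarrow> rat) \<Rightarrow> rat" where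
  "counit f = f empty_cposet"

definition hopf_algebra :: "'c cposet set \<Rightarrow> bool" where
  "hopf_algebra F \<longleftrightarrow>
     \<comment> \<open>vector space\<close>
     fzero \<in> Hsp F \<and> (\<forall>f\<in>Hsp F. \<forall>g\<in>Hsp F. fadd f g \<in> Hsp F) \<and> (\<forall>c. \<forall>f\<in>Hsp F. fscale c f \<in> Hsp F)
     \<comment> \<open>unital associative algebra with bilinear product\<close>
   \<and> (\<forall>f\<in>Hsp F. \<forall>g\<in>Hsp F. star F f g \<in> Hsp F) \<and> unitH F \<in> Hsp F
   \<and> (\<forall>f\<in>Hsp F. \<forall>g\<in>Hsp F. \<forall>h\<in>Hsp F. star F (star F f g) h = star F f (star F g h))
   \<and> (\<forall>f\<in>Hsp F. star F (unitH F) f = f \<and> star F f (unitH F) = f)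
   \<and> (\<forall>f\<in>Hsp F. \<forall>g\<in>Hsp F. \<forall>h\<in>Hsp F.
        star F (fadd f g) h = fadd (star F f h) (star F g h)
      \<and> star F h (fadd f g) = fadd (star F h f) (star F h g))
   \<and> (\<forall>c. \<forall>f\<in>Hsp F. \<forall>g\<in>Hsp F.
        star F (fscale c f) g = fscale c (star F f g) \<and> star F f (fscale c g) = fscale c (star F f g))
     \<comment> \<open>counital coassociative coalgebra with linear structure maps\<close>
   \<and> (\<forall>f\<in>Hsp F. cop F f \<in> Hsp2 F)
   \<and> (\<forall>f\<in>Hsp F. \<forall>g\<in>Hsp F. cop F (fadd f g) = fadd (cop F f) (cop F g)
        \<and> counit (fadd f g) = counit f + counit g)
   \<and> (\<forall>c. \<forall>f\<in>Hsp F. cop F (fscale c f) = fscale c (cop F f) \<and> counit (fscale c f) = c * counit f)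
   \<and> (\<forall>f\<in>Hsp F. \<forall>A\<in>F. \<forall>B\<in>F. \<forall>C\<in>F. cop F f (dsum A B, C) = cop F f (A, dsum B C))
   \<and> (\<forall>f\<in>Hsp F. (\<lambda>N. cop F f (empty_cposet, N)) = f \<and> (\<lambda>M. cop F f (M, empty_cposet)) = f)
     \<comment> \<open>bialgebra compatibility\<close>
   \<and> (\<forall>f\<in>Hsp F. \<forall>g\<in>Hsp F. cop F (star F f g) = star2 F (cop F f) (cop F g))
   \<and> cop F (unitH F) = unit2 F
   \<and> (\<forall>f\<in>Hsp F. \<forall>g\<in>Hsp F. counit (star F f g) = counit f * counit g)
   \<and> counit (unitH F) = 1
     \<comment> \<open>antipode: m (S \<otimes> id) \<Delta> = \<eta> \<epsilon> = m (id \<otimes> S) \<Delta>\<close>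
   \<and> (\<exists>S. (\<forall>f\<in>Hsp F. S f \<in> Hsp F)
        \<and> (\<forall>f\<in>Hsp F. \<forall>g\<in>Hsp F. S (fadd f g) = fadd (S f) (S g))
        \<and> (\<forall>c. \<forall>f\<in>Hsp F. S (fscale c f) = fscale c (S f))
        \<and> (\<forall>f\<in>Hsp F.
             mult2 F (\<lambda>(A, B). S (\<lambda>X. cop F f (X, B)) A) = fscale (counit f) (unitH F)
           \<and> mult2 F (\<lambda>(A, B). S (\<lambda>Y. cop F f (A, Y)) B) = fscale (counit f) (unitH F)))"

definition Hdeg :: "'c cposet set \<Rightarrow> nat \<Rightarrow> ('c cposet \<Rightarrow> rat) set" where
  "Hdeg F n = {f \<in> Hsp F. \<forall>P. f P \<noteq> 0 \<longrightarrow> card (carr P) = n}"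

definition hproj :: "nat \<Rightarrow> ('c cposet \<Rightarrow> rat) \<Rightarrow> 'c cposet \<Rightarrow> rat" where
  "hproj n f = (\<lambda>P. if card (carr P) = n then f P else 0)"

definition degs :: "('c cposet \<Rightarrow> rat) \<Rightarrow> nat set" where
  "degs f = {n. \<exists>P. f P \<noteq> 0 \<and> card (carr P) = n}"

definition graded_connected :: "'c cposet set \<Rightarrow> bool" where
  "graded_connected F \<longleftrightarrow>
     \<comment> \<open>H = direct sum of the H_n\<close>
     (\<forall>f\<in>Hsp F. finite (degs f) \<and> (\<forall>n. hproj n f \<in> Hdeg F n)
         \<and> f = (\<lambda>P. \<Sum>n\<in>degs f. hproj n f P))
     \<comment> \<open>graded algebra\<close>
   \<and> (\<forall>m n f g. f \<in> Hdeg F m \<and> g \<in> Hdeg F n \<longrightarrow> star F f g \<in> Hdeg F (m + n))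
   \<and> unitH F \<in> Hdeg F 0
     \<comment> \<open>graded coalgebra: \<Delta>(H_n) \<subseteq> sum over i+j=n of H_i \<otimes> H_j, \<epsilon>(H_n) = 0 for n > 0\<close>
   \<and> (\<forall>n f. f \<in> Hdeg F n \<longrightarrow> (\<forall>M N. cop F f (M, N) \<noteq> 0 \<longrightarrow> card (carr M) + card (carr N) = n))
   \<and> (\<forall>n f. f \<in> Hdeg F n \<and> 0 < n \<longrightarrow> counit f = 0)
     \<comment> \<open>connected: H_0 = Q 1\<close>
   \<and> (\<forall>f\<in>Hdeg F 0. \<exists>c. f = fscale c (unitH F))"

definition cocommutative :: "'c cposet set \<Rightarrow> bool" where
  "cocommutative F \<longleftrightarrow> (\<forall>f\<in>Hsp F. \<forall>M N. cop F f (M, N) = cop F f (N, M))"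

definition primitives :: "'c cposet set \<Rightarrow> ('c cposet \<Rightarrow> rat) set" where
  "primitives F = {f \<in> Hsp F. cop F f = (\<lambda>(M, N). f M * unitH F N + unitH F M * f N)}"

definition rspan :: "('x \<Rightarrow> rat) set \<Rightarrow> ('x \<Rightarrow> rat) set" where
  "rspan X = {f. \<exists>T c. finite T \<and> T \<subseteq> X \<and> f = (\<lambda>x. \<Sum>t\<in>T. c t * t x)}"

definition bracket :: "'c cposet set \<Rightarrow> ('c cposet \<Rightarrow> rat) \<Rightarrow> ('c cposet \<Rightarrow> rat) \<Rightarrow> 'c cposet \<Rightarrow> rat" where
  "bracket F f g = fadd (star F f g) (fscale (-1) (star F g f))"

definition rat_algebra :: "(rat \<Rightarrow> 'a::ring_1 \<Rightarrow> 'a) \<Rightarrow> bool" where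
  "rat_algebra sm \<longleftrightarrow>
     (\<forall>a x y. sm a (x + y) = sm a x + sm a y)
   \<and> (\<forall>a b x. sm (a + b) x = sm a x + sm b x)
   \<and> (\<forall>a b x. sm (a * b) x = sm a (sm b x))
   \<and> (\<forall>x. sm 1 x = x)
   \<and> (\<forall>a x y. sm a (x * y) = sm a x * y \<and> sm a (x * y) = x * sm a y)"

text \<open>(H_F, inclusion of n) has the universal property of U(n) with respect to
  the Q-algebra (\<open>'a\<close>, sm): every Lie algebra map n \<rightarrow> A extends uniquely to an
  algebra map H_F \<rightarrow> A.\<close>
definition uea_property :: "'c cposet set \<Rightarrow> ('c cposet \<Rightarrow> rat) set \<Rightarrow> (rat \<Rightarrow> 'a::ring_1 \<Rightarrow> 'a) \<Rightarrow> bool" where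
  "uea_property F n sm \<longleftrightarrow>
    (\<forall>\<phi> :: ('c cposet \<Rightarrow> rat) \<Rightarrow> 'a.
       (\<forall>f\<in>n. \<forall>g\<in>n. \<phi> (fadd f g) = \<phi> f + \<phi> g)
     \<and> (\<forall>c. \<forall>f\<in>n. \<phi> (fscale c f) = sm c (\<phi> f))
     \<and> (\<forall>f\<in>n. \<forall>g\<in>n. \<phi> (bracket F f g) = \<phi> f * \<phi> g - \<phi> g * \<phi> f)
     \<longrightarrow>
       (\<exists>\<Phi>. (\<forall>f\<in>Hsp F. \<forall>g\<in>Hsp F. \<Phi> (fadd f g) = \<Phi> f + \<Phi> g)
           \<and> (\<forall>c. \<forall>f\<in>Hsp F. \<Phi> (fscale c f) = sm c (\<Phi> f))
           \<and> (\<forall>f\<in>Hsp F. \<forall>g\<in>Hsp F. \<Phi> (star F f g) = \<Phi> f * \<Phi> g)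
           \<and> \<Phi> (unitH F) = 1
           \<and> (\<forall>f\<in>n. \<Phi> f = \<phi> f))
     \<and> (\<forall>\<Phi>1 \<Phi>2.
          (\<forall>f\<in>Hsp F. \<forall>g\<in>Hsp F. \<Phi>1 (fadd f g) = \<Phi>1 f + \<Phi>1 g)
        \<and> (\<forall>c. \<forall>f\<in>Hsp F. \<Phi>1 (fscale c f) = sm c (\<Phi>1 f))
        \<and> (\<forall>f\<in>Hsp F. \<forall>g\<in>Hsp F. \<Phi>1 (star F f g) = \<Phi>1 f * \<Phi>1 g)
        \<and> \<Phi>1 (unitH F) = 1 \<and> (\<forall>f\<in>n. \<Phi>1 f = \<phi> f)
        \<and> (\<forall>f\<in>Hsp F. \<forall>g\<in>Hsp F. \<Phi>2 (fadd f g) = \<Phi>2 f + \<Phi>2 g)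
        \<and> (\<forall>c. \<forall>f\<in>Hsp F. \<Phi>2 (fscale c f) = sm c (\<Phi>2 f))
        \<and> (\<forall>f\<in>Hsp F. \<forall>g\<in>Hsp F. \<Phi>2 (star F f g) = \<Phi>2 f * \<Phi>2 g)
        \<and> \<Phi>2 (unitH F) = 1 \<and> (\<forall>f\<in>n. \<Phi>2 f = \<phi> f)
        \<longrightarrow> (\<forall>f\<in>Hsp F. \<Phi>1 f = \<Phi>2 f)))"

end

theory Submission
  imports Defs "HOL-Library.Function_Algebras" "HOL-Library.Product_Plus" "HOL-Library.Multiset" "HOL-Library.FuncSet"
begin

text \<open>
The antipode is defined by the usual recursion on the size of the poset, from the left, and a sum over
chains of two order ideals shows that it also satisfies the recursion from the right.

A function is primitive iff it is supported on connected posets. The universal property rests on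
evaluating a product of \<open>k\<close> connected indicator functions at a poset with at least \<open>k\<close> components: every factor
uses up elements of one component only, so the value vanishes unless there are exactly \<open>k\<close> components and the
factors are, up to order, their indicators. Triangularity with respect to the number of components shows
that these products span \<open>H\<close>. Given a Lie map \<open>\<phi>\<close> into an algebra \<open>A\<close>, consider the subalgebra of
\<open>H \<times> A\<close> generated by the pairs \<open>(d, \<phi> d)\<close>. Reordering a word changes its product by shorter words,
so the span of the words of length at most \<open>k\<close> is, modulo shorter words, spanned by one word per multiset,
and by the evaluation the first components of those are independent. Hence the subalgebra is the graph
of a map \<open>H \<rightarrow> A\<close>, the required extension. This avoids constructing the enveloping algebra or
invoking Poincare-Birkhoff-Witt.
\<close>

section \<open>Isomorphisms, order ideals and disjoint sums\<close>

text \<open>The extension is forced on words, but a function in \<open>Hsp F\<close> is a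
  combination of words in many ways, so the difficulty is that the value must not depend on the
  choice. The Lie hypothesis only allows neighbouring letters to be exchanged at the cost of a
  combination of shorter words; the proof shows that \<open>Hsp F\<close> has no relations among
  words beyond those that follow from such exchanges. Components of a poset are never constructed. A
  function that is constant along comparabilities counts them from below, and evaluation at one
  well-chosen poset per word takes the place of a dual basis. Closure under disjoint unions supplies
  these posets, closure under convex sub-posets makes ideals and their complements legal arguments,
  and nonnegativity of products of indicators excludes cancellation. Finiteness of the color type
  enters once, in bounding the number of isomorphism classes of a given size.\<close>

definition isom :: "(nat \<Rightarrow> nat) \<Rightarrow> 'c cposet \<Rightarrow> 'c cposet \<Rightarrow> bool" where
  "isom h P Q \<longleftrightarrow> bij_betw h (carr P) (carr Q)
     \<and> (\<forall>x\<in>carr P. \<forall>y\<in>carr P. lev Q (h x) (h y) \<longleftrightarrow> lev P x y)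
     \<and> (\<forall>x\<in>carr P. colr Q (h x) = colr P x)"

lemma cposet_iso_iff: "cposet_iso P Q \<longleftrightarrow> (\<exists>h. isom h P Q)"
  by (simp add: cposet_iso_def isom_def)

lemma isomI:
  assumes "\<And>x. x \<in> carr P \<Longrightarrow> h x \<in> carr Q \<and> g (h x) = x"
    and "\<And>y. y \<in> carr Q \<Longrightarrow> g y \<in> carr P \<and> h (g y) = y"
    and "\<And>x y. x \<in> carr P \<Longrightarrow> y \<in> carr P \<Longrightarrow> lev Q (h x) (h y) \<longleftrightarrow> lev P x y"
    and "\<And>x. x \<in> carr P \<Longrightarrow> colr Q (h x) = colr P x"
  shows "isom h P Q"
  unfolding isom_def using assms by (auto intro!: bij_betw_byWitness[where f'=g])

lemma isom_inv:
  assumes "isom h P Q" shows "isom (inv_into (carr P) h) Q P"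
proof -
  have b: "bij_betw h (carr P) (carr Q)" using assms by (simp add: isom_def)
  let ?g = "inv_into (carr P) h"
  have g: "\<And>y. y \<in> carr Q \<Longrightarrow> ?g y \<in> carr P \<and> h (?g y) = y"
    using b by (metis bij_betw_def f_inv_into_f inv_into_into)
  have h: "\<And>x. x \<in> carr P \<Longrightarrow> h x \<in> carr Q \<and> ?g (h x) = x"
    using b by (metis bij_betw_def bij_betw_inv_into_left image_eqI)
  show ?thesis
    by (rule isomI[where g=h]) (use g h assms in \<open>auto simp: isom_def\<close>, metis+)
qed

lemma isom_comp: "isom h P Q \<Longrightarrow> isom k Q R \<Longrightarrow> isom (k \<circ> h) P R"
  unfolding isom_def by (auto simp: bij_betw_apply intro: bij_betw_trans)

lemma iso_refl [simp]: "cposet_iso P P"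
  unfolding cposet_iso_iff by (rule exI[of _ id]) (simp add: isom_def)

lemma iso_sym: "cposet_iso P Q \<Longrightarrow> cposet_iso Q P"
  unfolding cposet_iso_iff using isom_inv by blast

lemma iso_trans: "cposet_iso P Q \<Longrightarrow> cposet_iso Q R \<Longrightarrow> cposet_iso P R"
  unfolding cposet_iso_iff using isom_comp by blast

lemma iso_card: "cposet_iso P Q \<Longrightarrow> card (carr P) = card (carr Q)"
  unfolding cposet_iso_def using bij_betw_same_card by blast

lemma carr_restr [simp]: "carr (restr P S) = S"
  and lev_restr [simp]: "lev (restr P S) x y \<longleftrightarrow> x \<in> S \<and> y \<in> S \<and> lev P x y"
  and colr_restr [simp]: "colr (restr P S) = colr P"
  by (auto simp: restr_def)

lemma restr_restr [simp]: "S \<subseteq> T \<Longrightarrow> restr (restr P T) S = restr P S"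
  by (auto simp: restr_def fun_eq_iff)

lemma wf_cposetD:
  assumes "wf_cposet P"
  shows "finite (carr P)" and "lev P x y \<Longrightarrow> x \<in> carr P" and "lev P x y \<Longrightarrow> y \<in> carr P"
    and "x \<in> carr P \<Longrightarrow> lev P x x" and "lev P x y \<Longrightarrow> lev P y x \<Longrightarrow> x = y"
    and "lev P x y \<Longrightarrow> lev P y z \<Longrightarrow> lev P x z"
  using assms unfolding wf_cposet_def by blast+

text \<open>An equality of records and not only an isomorphism: in a well-formed poset
  \<open>lev\<close> is false off the carrier, and \<open>restr\<close> leaves \<open>colr\<close>
  untouched.\<close>

lemma restr_carr [simp]: "wf_cposet P \<Longrightarrow> restr P (carr P) = P"
proof -
  assume "wf_cposet P"
  note wf_cposetD(2,3)[OF this]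
  thus ?thesis by (intro cposet.equality) (auto simp: fun_eq_iff)
qed

lemma wf_restr: "wf_cposet P \<Longrightarrow> S \<subseteq> carr P \<Longrightarrow> wf_cposet (restr P S)"
  unfolding wf_cposet_def lev_restr carr_restr
  by (intro conjI; (elim conjE)?; (blast intro: finite_subset)?)

lemma isom_restr:
  assumes "isom h P Q" "I \<subseteq> carr P" shows "isom h (restr P I) (restr Q (h ` I))"
proof -
  have "bij_betw h I (h ` I)" using assms by (auto simp: isom_def bij_betw_def intro: inj_on_subset)
  moreover have "x \<in> carr P" if "x \<in> I" for x using assms that by blast
  ultimately show ?thesis using assms(1) unfolding isom_def by simp
qed

section \<open>Order ideals and sums over them\<close>

lemma ideal_sub: "I \<in> order_ideals P \<Longrightarrow> I \<subseteq> carr P"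
  by (auto simp: order_ideals_def)

lemma finite_order_ideals: "finite (carr P) \<Longrightarrow> finite (order_ideals P)"
  by (rule finite_subset[of _ "Pow (carr P)"]) (auto simp: order_ideals_def)

lemma empty_ideal [simp]: "{} \<in> order_ideals P"
  and carr_ideal [simp]: "carr P \<in> order_ideals P"
  by (auto simp: order_ideals_def)

lemma isom_image_ideal:
  assumes "isom h P Q" "I \<in> order_ideals P" shows "h ` I \<in> order_ideals Q"
proof -
  have "carr Q = h ` carr P" using assms by (auto simp: isom_def bij_betw_def)
  moreover have "lev Q (h x) (h y) \<longleftrightarrow> lev P x y" if "x \<in> carr P" "y \<in> carr P" for x y
    using assms that by (simp add: isom_def)
  ultimately show ?thesis
    using assms(2) unfolding order_ideals_def by (clarsimp simp: image_mono) blast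
qed

lemma isom_ideals:
  assumes "isom h P Q"
  shows "bij_betw ((`) h) (order_ideals P) (order_ideals Q)"
proof -
  let ?g = "inv_into (carr P) h"
  have b: "bij_betw h (carr P) (carr Q)" using assms by (simp add: isom_def)
  have g: "isom ?g Q P" using isom_inv[OF assms] .
  show ?thesis
  proof (rule bij_betw_byWitness[where f'="(`) ?g"])
    show "\<forall>a\<in>order_ideals P. ?g ` h ` a = a"
      using b by (auto simp: order_ideals_def bij_betw_def inv_into_image_cancel)
    show "\<forall>a'\<in>order_ideals Q. h ` ?g ` a' = a'"
      using b by (auto simp: order_ideals_def bij_betw_def image_inv_into_cancel)
  qed (use isom_image_ideal[OF assms] isom_image_ideal[OF g] in auto)
qed

lemma sum_ideals_isom:
  assumes "isom h P Q" and "\<And>I. I \<in> order_ideals P \<Longrightarrow> G I = K (h ` I)"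
  shows "sum G (order_ideals P) = sum K (order_ideals Q)"
  using assms(2) sum.reindex_bij_betw[OF isom_ideals[OF assms(1)], of K]
  by (metis (no_types, lifting) sum.cong)

lemma isom_compl:
  assumes "isom h P Q" "I \<subseteq> carr P" shows "carr Q - h ` I = h ` (carr P - I)"
  using assms inj_on_image_set_diff[of h "carr P" "carr P" I] by (simp add: isom_def bij_betw_def)

lemma ideal_convex: "I \<in> order_ideals P \<Longrightarrow> convex_sub P I"
  and ideal_compl_convex: "I \<in> order_ideals P \<Longrightarrow> convex_sub P (carr P - I)"
  unfolding order_ideals_def convex_sub_def by auto

lemma ideals_restr_ideal_iff:
  assumes "J \<in> order_ideals P"
  shows "I \<in> order_ideals (restr P J) \<longleftrightarrow> I \<in> order_ideals P \<and> I \<subseteq> J"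
  using assms unfolding order_ideals_def mem_Collect_eq lev_restr carr_restr
  by (meson subsetD subset_trans)

lemma ideals_restr_compl_iff:
  assumes "I \<in> order_ideals P"
  shows "K \<in> order_ideals (restr P (carr P - I)) \<longleftrightarrow> I \<inter> K = {} \<and> I \<union> K \<in> order_ideals P"
  using assms unfolding order_ideals_def mem_Collect_eq lev_restr carr_restr
  by (intro iffI conjI ballI impI subsetI; blast)

text \<open>Both sides run over the chains of two ideals, \<open>I\<close> inside \<open>J\<close>:
  the left side picks the larger ideal first, the right side the smaller one and then the difference
  \<open>K = J - I\<close>. Associativity of the product and the comparison of the two antipode
  recursions both rest on this exchange.\<close>

lemma sum_ideal_chains:
  assumes "finite (carr P)"
  shows "(\<Sum>J\<in>order_ideals P. \<Sum>I\<in>order_ideals (restr P J). X I J)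
       = (\<Sum>I\<in>order_ideals P. \<Sum>K\<in>order_ideals (restr P (carr P - I)). X I (I \<union> K))"
proof -
  have fin: "finite (order_ideals P)" "\<And>J. J \<in> order_ideals P \<Longrightarrow> finite (order_ideals (restr P J))"
     "\<And>J. finite (order_ideals (restr P (carr P - J)))"
    using assms by (auto intro!: finite_order_ideals intro: finite_subset[OF ideal_sub])
  have "(\<Sum>J\<in>order_ideals P. \<Sum>I\<in>order_ideals (restr P J). X I J)
     = (\<Sum>(J,I)\<in>(SIGMA J:order_ideals P. order_ideals (restr P J)). X I J)"
    by (rule sum.Sigma) (use fin in auto)
  also have "\<dots> = (\<Sum>(I,K)\<in>(SIGMA I:order_ideals P. order_ideals (restr P (carr P - I))). X I (I \<union> K))"
    by (rule sum.reindex_bij_witness[where i="\<lambda>(I,K). (I \<union> K, I)" and j="\<lambda>(J,I). (I, J - I)"])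
       (auto simp: ideals_restr_ideal_iff ideals_restr_compl_iff Un_absorb1)
  also have "\<dots> = (\<Sum>I\<in>order_ideals P. \<Sum>K\<in>order_ideals (restr P (carr P - I)). X I (I \<union> K))"
    by (rule sum.Sigma[symmetric]) (use fin in auto)
  finally show ?thesis .
qed

section \<open>Disjoint sums, coded by even and odd numbers\<close>

lemma even_odd_image_iff: "x \<in> (\<lambda>x. 2*x) ` I \<union> (\<lambda>x. 2*x+1) ` J \<longleftrightarrow>
    (if even x then x div 2 \<in> I else x div 2 \<in> J)" for x :: nat
  by (auto simp: image_iff double_not_eq_Suc_double Suc_double_not_eq_double elim!: evenE oddE)

lemma carr_dsum_iff [simp]: "x \<in> carr (dsum P Q) \<longleftrightarrow>
    (if even x then x div 2 \<in> carr P else x div 2 \<in> carr Q)"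
  unfolding even_odd_image_iff[symmetric] by (simp add: dsum_def)

lemma lev_dsum [simp]: "lev (dsum P Q) x y \<longleftrightarrow>
    (if even x then even y \<and> x div 2 \<in> carr P \<and> y div 2 \<in> carr P \<and> lev P (x div 2) (y div 2)
     else odd y \<and> x div 2 \<in> carr Q \<and> y div 2 \<in> carr Q \<and> lev Q (x div 2) (y div 2))"
  and colr_dsum [simp]: "colr (dsum P Q) x = (if even x then colr P (x div 2) else colr Q (x div 2))"
  by (auto simp: dsum_def)

lemma finite_dsum: "finite (carr P) \<Longrightarrow> finite (carr Q) \<Longrightarrow> finite (carr (dsum P Q))"
  by (simp add: dsum_def)

lemma card_dsum:
  assumes "finite (carr P)" "finite (carr Q)"
  shows "card (carr (dsum P Q)) = card (carr P) + card (carr Q)"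
proof -
  have "(\<lambda>x. 2*x) ` carr P \<inter> (\<lambda>x. 2*x+1) ` carr Q = {}"
    by (auto, presburger)
  thus ?thesis using assms
    by (simp add: dsum_def card_Un_disjoint card_image inj_on_def)
qed

lemma wf_dsum:
  assumes "wf_cposet P" "wf_cposet Q" shows "wf_cposet (dsum P Q)"
proof -
  have eq: "x div 2 = y div 2 \<Longrightarrow> even x = even y \<Longrightarrow> x = y" for x y :: nat by presburger
  have P: "finite (carr P)" "\<And>x. x \<in> carr P \<Longrightarrow> lev P x x" "\<And>x y. lev P x y \<Longrightarrow> lev P y x \<Longrightarrow> x = y"
    "\<And>x y z. lev P x y \<Longrightarrow> lev P y z \<Longrightarrow> lev P x z" using assms unfolding wf_cposet_def by blast+
  have Q: "finite (carr Q)" "\<And>x. x \<in> carr Q \<Longrightarrow> lev Q x x" "\<And>x y. lev Q x y \<Longrightarrow> lev Q y x \<Longrightarrow> x = y"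
    "\<And>x y z. lev Q x y \<Longrightarrow> lev Q y z \<Longrightarrow> lev Q x z" using assms unfolding wf_cposet_def by blast+
  show ?thesis unfolding wf_cposet_def
  proof (intro conjI allI impI ballI)
    show "finite (carr (dsum P Q))" using P Q by (simp add: finite_dsum)
    fix x y z
    show "x \<in> carr (dsum P Q) \<Longrightarrow> lev (dsum P Q) x x" using P(2) Q(2) by (auto split: if_splits)
    show "lev (dsum P Q) x y \<Longrightarrow> x \<in> carr (dsum P Q)" "lev (dsum P Q) x y \<Longrightarrow> y \<in> carr (dsum P Q)"
      by (auto split: if_splits)
    show "x = y" if "lev (dsum P Q) x y \<and> lev (dsum P Q) y x"
    proof (rule eq)
      show "even x = even y" using that unfolding lev_dsum by metis
      show "x div 2 = y div 2"
        using that P(3)[of "x div 2" "y div 2"] Q(3)[of "x div 2" "y div 2"] unfolding lev_dsum by metis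
    qed
    show "lev (dsum P Q) x y \<and> lev (dsum P Q) y z \<Longrightarrow> lev (dsum P Q) x z"
      using P(4) Q(4) unfolding lev_dsum by (metis (full_types))
  qed
qed

lemma dsum_restr:
  "restr (dsum P Q) ((\<lambda>x. 2*x) ` I \<union> (\<lambda>x. 2*x+1) ` J) = dsum (restr P I) (restr Q J)"
  if "I \<subseteq> carr P" "J \<subseteq> carr Q"
proof -
  have a: "x \<in> (\<lambda>x. 2*x) ` I \<union> (\<lambda>x. 2*x+1) ` J \<longleftrightarrow> (if even x then x div 2 \<in> I else x div 2 \<in> J)" for x
    by (rule even_odd_image_iff)
  have "carr (restr (dsum P Q) ((\<lambda>x. 2*x) ` I \<union> (\<lambda>x. 2*x+1) ` J)) = carr (dsum (restr P I) (restr Q J))"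
    by (simp add: dsum_def)
  moreover have "lev (restr (dsum P Q) ((\<lambda>x. 2*x) ` I \<union> (\<lambda>x. 2*x+1) ` J)) = lev (dsum (restr P I) (restr Q J))"
    unfolding fun_eq_iff lev_restr a using that by auto
  moreover have "colr (restr (dsum P Q) ((\<lambda>x. 2*x) ` I \<union> (\<lambda>x. 2*x+1) ` J)) = colr (dsum (restr P I) (restr Q J))"
    by (simp add: fun_eq_iff)
  ultimately show ?thesis by (simp add: cposet.equality)
qed

text \<open>Nothing in \<open>M\<close> is comparable to anything in \<open>N\<close>, so an ideal
  of the sum is an arbitrary pair of ideals, and complements are taken in each summand separately.
  This is the combinatorial content of the compatibility of product and coproduct.\<close>

lemma sum_ideals_dsum:
  "(\<Sum>L\<in>order_ideals (dsum M N). G (restr (dsum M N) L) (restr (dsum M N) (carr (dsum M N) - L)))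
   = (\<Sum>I\<in>order_ideals M. \<Sum>J\<in>order_ideals N.
        G (dsum (restr M I) (restr N J)) (dsum (restr M (carr M - I)) (restr N (carr N - J))))"
proof -
  let ?c = "\<lambda>I J. (\<lambda>x. 2*x) ` I \<union> (\<lambda>x. 2*x+1) ` (J::nat set)"
  have c: "x \<in> ?c I J \<longleftrightarrow> (if even x then x div 2 \<in> I else x div 2 \<in> J)" for x I J
    by (rule even_odd_image_iff)
  have bij: "bij_betw (\<lambda>(I,J). ?c I J) (order_ideals M \<times> order_ideals N) (order_ideals (dsum M N))"
  proof (rule bij_betw_byWitness[where f'="\<lambda>L. ({x. 2*x \<in> L}, {x. 2*x+1 \<in> L})"])
    show "\<forall>a\<in>order_ideals M \<times> order_ideals N.
       (\<lambda>L. ({x. 2*x \<in> L}, {x. 2*x+1 \<in> L})) (case a of (I, J) \<Rightarrow> ?c I J) = a"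
      by (auto simp: image_iff) presburger+
    show "\<forall>L\<in>order_ideals (dsum M N). (case ({x. 2*x \<in> L}, {x. 2*x+1 \<in> L}) of (I, J) \<Rightarrow> ?c I J) = L"
    proof (intro ballI set_eqI)
      fix L x
      show "x \<in> (case ({x. 2*x \<in> L}, {x. 2*x+1 \<in> L}) of (I, J) \<Rightarrow> ?c I J) \<longleftrightarrow> x \<in> L"
        unfolding prod.case c by (auto elim!: evenE oddE)
    qed
    show "(\<lambda>(I, J). ?c I J) ` (order_ideals M \<times> order_ideals N) \<subseteq> order_ideals (dsum M N)"
    proof (clarify, unfold order_ideals_def mem_Collect_eq, intro conjI subsetI ballI impI)
      fix I J x assume I: "I \<subseteq> carr M \<and> (\<forall>y\<in>I. \<forall>x\<in>carr M. lev M x y \<longrightarrow> x \<in> I)"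
        and J: "J \<subseteq> carr N \<and> (\<forall>y\<in>J. \<forall>x\<in>carr N. lev N x y \<longrightarrow> x \<in> J)"
      show "x \<in> carr (dsum M N)" if "x \<in> ?c I J"
        using that I J unfolding c carr_dsum_iff by auto
      show "x \<in> ?c I J" if "y \<in> ?c I J" "x \<in> carr (dsum M N)" "lev (dsum M N) x y" for y
        using that I J unfolding c carr_dsum_iff lev_dsum by metis
    qed
    show "(\<lambda>L. ({x. 2*x \<in> L}, {x. 2*x+1 \<in> L})) ` order_ideals (dsum M N) \<subseteq> order_ideals M \<times> order_ideals N"
    proof (clarsimp, intro conjI)
      fix L assume "L \<in> order_ideals (dsum M N)"
      then have L: "\<And>x. x \<in> L \<Longrightarrow> x \<in> carr (dsum M N)"
        "\<And>x y. y \<in> L \<Longrightarrow> x \<in> carr (dsum M N) \<Longrightarrow> lev (dsum M N) x y \<Longrightarrow> x \<in> L"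
        by (auto simp: order_ideals_def simp del: carr_dsum_iff lev_dsum)
      show "{x. 2*x \<in> L} \<in> order_ideals M"
      proof (unfold order_ideals_def mem_Collect_eq, intro conjI subsetI ballI impI)
        show "x \<in> carr M" if "x \<in> {x. 2*x \<in> L}" for x using L(1)[of "2*x"] that by simp
        show "2*x \<in> L" if "y \<in> {x. 2*x \<in> L}" "x \<in> carr M" "lev M x y" for x y
          using L(2)[of "2*y" "2*x"] L(1)[of "2*y"] that by simp
      qed
      show "{x. Suc (2*x) \<in> L} \<in> order_ideals N"
      proof (unfold order_ideals_def mem_Collect_eq, intro conjI subsetI ballI impI)
        show "x \<in> carr N" if "x \<in> {x. Suc (2*x) \<in> L}" for x using L(1)[of "Suc (2*x)"] that by simp
        show "Suc (2*x) \<in> L" if "y \<in> {x. Suc (2*x) \<in> L}" "x \<in> carr N" "lev N x y" for x y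
          using L(2)[of "Suc (2*y)" "Suc (2*x)"] L(1)[of "Suc (2*y)"] that by simp
      qed
    qed
  qed
  have comp: "carr (dsum M N) - ?c I J = ?c (carr M - I) (carr N - J)" for I J
    by (rule set_eqI) (simp only: Diff_iff carr_dsum_iff c, auto)
  have "(\<Sum>L\<in>order_ideals (dsum M N). G (restr (dsum M N) L) (restr (dsum M N) (carr (dsum M N) - L)))
     = (\<Sum>(I,J)\<in>order_ideals M \<times> order_ideals N.
        G (restr (dsum M N) (?c I J)) (restr (dsum M N) (?c (carr M - I) (carr N - J))))"
    unfolding sum.reindex_bij_betw[OF bij, symmetric] comp[symmetric] by (simp add: case_prod_unfold)
  also have "\<dots> = (\<Sum>(I,J)\<in>order_ideals M \<times> order_ideals N.
        G (dsum (restr M I) (restr N J)) (dsum (restr M (carr M - I)) (restr N (carr N - J))))"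
    by (rule sum.cong) (auto simp: dsum_restr[simplified] ideal_sub)
  finally show ?thesis by (simp add: sum.cartesian_product)
qed

lemma dsum_iso_cong:
  assumes "cposet_iso M M'" "cposet_iso N N'" shows "cposet_iso (dsum M N) (dsum M' N')"
proof -
  obtain h k where h: "isom h M M'" and k: "isom k N N'" using assms by (auto simp: cposet_iso_iff)
  let ?h' = "inv_into (carr M) h" and ?k' = "inv_into (carr N) k"
  have h': "\<And>y. y \<in> carr M' \<Longrightarrow> ?h' y \<in> carr M \<and> h (?h' y) = y"
    "\<And>x. x \<in> carr M \<Longrightarrow> h x \<in> carr M' \<and> ?h' (h x) = x"
    using h unfolding isom_def
    by (metis bij_betw_def f_inv_into_f inv_into_into, metis bij_betw_apply bij_betw_inv_into_left)
  have k': "\<And>y. y \<in> carr N' \<Longrightarrow> ?k' y \<in> carr N \<and> k (?k' y) = y"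
    "\<And>x. x \<in> carr N \<Longrightarrow> k x \<in> carr N' \<and> ?k' (k x) = x"
    using k unfolding isom_def
    by (metis bij_betw_def f_inv_into_f inv_into_into, metis bij_betw_apply bij_betw_inv_into_left)
  have "isom (\<lambda>x. if even x then 2 * h (x div 2) else 2 * k (x div 2) + 1) (dsum M N) (dsum M' N')"
    by (rule isomI[where g="\<lambda>x. if even x then 2 * ?h' (x div 2) else 2 * ?k' (x div 2) + 1"])
       (use h k h' k' in \<open>auto simp: isom_def split: if_splits\<close>)
  thus ?thesis by (auto simp: cposet_iso_iff)
qed

lemma dsum_comm: "cposet_iso (dsum M N) (dsum N M)"
  unfolding cposet_iso_iff
  by (rule exI, rule isomI[where h="\<lambda>x. if even x then x + 1 else x - 1" and g="\<lambda>x. if even x then x + 1 else x - 1"])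
     (auto elim!: oddE)

lemma dsum_assoc: "cposet_iso (dsum (dsum A B) C) (dsum A (dsum B C))"
proof -
  let ?h = "\<lambda>x. if even x then if even (x div 2) then 2 * (x div 2 div 2) else 2 * (2 * (x div 2 div 2)) + 1
            else 2 * (2 * (x div 2) + 1) + (1::nat)"
  let ?g = "\<lambda>x. if even x then 2 * (2 * (x div 2)) else if even (x div 2) then 2 * (2 * (x div 2 div 2) + 1)
            else 2 * (x div 2 div 2) + (1::nat)"
  have "isom ?h (dsum (dsum A B) C) (dsum A (dsum B C))"
    by (rule isomI[where g="?g"]; auto split: if_splits simp del: odd_two_times_div_two_nat; presburger)
  thus ?thesis by (auto simp: cposet_iso_iff)
qed

lemma carr_empty [simp]: "carr empty_cposet = {}" by (simp add: empty_cposet_def)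

lemma iso_empty_iff [simp]: "cposet_iso empty_cposet P \<longleftrightarrow> carr P = {}"
  by (auto simp: cposet_iso_def bij_betw_def)

text \<open>The map \<open>x div 2\<close> undoes the coding of both summands at once. It is
  injective because \<open>A\<close> and \<open>B\<close> are disjoint, and it creates no new
  relations because no element of \<open>A\<close> is comparable to one of \<open>B\<close>.\<close>

lemma dsum_split:
  assumes "wf_cposet P" "A \<union> B = carr P" "A \<inter> B = {}"
    "\<And>x y. x \<in> A \<Longrightarrow> y \<in> B \<Longrightarrow> \<not> lev P x y \<and> \<not> lev P y x"
  shows "cposet_iso (dsum (restr P A) (restr P B)) P"
proof -
  have "isom (\<lambda>x. x div 2) (dsum (restr P A) (restr P B)) P"
    by (rule isomI[where g="\<lambda>x. if x \<in> A then 2 * x else 2 * x + 1"])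
       (use assms in \<open>auto split: if_splits\<close>)
  thus ?thesis by (auto simp: cposet_iso_iff)
qed

lemma dsum_empty_right: "wf_cposet P \<Longrightarrow> cposet_iso (dsum P Q) P" if "carr Q = {}"
proof -
  assume "wf_cposet P"
  then have "isom (\<lambda>x. x div 2) (dsum P Q) P"
    by (intro isomI[where g="\<lambda>x. 2 * x"]) (use that in \<open>auto split: if_splits\<close>)
  thus ?thesis by (auto simp: cposet_iso_iff)
qed

lemma dsum_empty_left: "wf_cposet P \<Longrightarrow> carr Q = {} \<Longrightarrow> cposet_iso (dsum Q P) P"
  using dsum_empty_right dsum_comm iso_trans by blast

section \<open>The bialgebra\<close>

text \<open>\<open>Hsp\<close> without finite support. Most identities of the bialgebra and of the
  antipode depend on isomorphism invariance alone, and slices of a coproduct stay in this larger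
  space with no support bound to carry along.\<close>

definition invariant_funs :: "'c cposet set \<Rightarrow> ('c cposet \<Rightarrow> rat) set" where
  "invariant_funs F = {f. (\<forall>P. P \<notin> F \<longrightarrow> f P = 0) \<and> (\<forall>P\<in>F. \<forall>Q\<in>F. cposet_iso P Q \<longrightarrow> f P = f Q)}"

locale poset_family =
  fixes F :: "('c::finite) cposet set"
  assumes family_ok: "family_ok F"
begin

lemma F_wf: "P \<in> F \<Longrightarrow> wf_cposet P"
  and F_empty [simp]: "empty_cposet \<in> F"
  and F_iso: "P \<in> F \<Longrightarrow> wf_cposet Q \<Longrightarrow> cposet_iso P Q \<Longrightarrow> Q \<in> F"
  and F_convex: "P \<in> F \<Longrightarrow> convex_sub P S \<Longrightarrow> restr P S \<in> F"
  and F_dunion: "P \<in> F \<Longrightarrow> Q \<in> F \<Longrightarrow> carr P \<inter> carr Q = {} \<Longrightarrow> dunion P Q \<in> F"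
  using family_ok unfolding family_ok_def by blast+

lemma F_finite: "P \<in> F \<Longrightarrow> finite (carr P)"
  using F_wf wf_cposetD(1) by blast

lemma F_ideal [simp]: "P \<in> F \<Longrightarrow> I \<in> order_ideals P \<Longrightarrow> restr P I \<in> F"
  and F_compl [simp]: "P \<in> F \<Longrightarrow> I \<in> order_ideals P \<Longrightarrow> restr P (carr P - I) \<in> F"
  by (auto intro: F_convex ideal_convex ideal_compl_convex)

lemma F_restr_carr [simp]: "P \<in> F \<Longrightarrow> restr P (carr P) = P"
  by (simp add: F_wf)

lemma F_restr_empty [simp]: "P \<in> F \<Longrightarrow> restr P {} \<in> F"
  by (rule F_ideal) simp_all

text \<open>\<open>family_ok\<close> speaks of \<open>dunion\<close>, for posets that are disjoint
  as sets of numbers. The even and the odd half of \<open>dsum P Q\<close> are disjoint copies of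
  \<open>P\<close> and \<open>Q\<close>, and the identity map is an isomorphism from their
  \<open>dunion\<close> to \<open>dsum P Q\<close>.\<close>

lemma F_dsum [simp]:
  assumes "P \<in> F" "Q \<in> F" shows "dsum P Q \<in> F"
proof -
  let ?A = "(\<lambda>x. 2*x) ` carr P" and ?B = "(\<lambda>x. 2*x+1) ` carr Q"
  let ?D = "dsum P Q"
  have wf: "wf_cposet ?D" using assms by (simp add: wf_dsum F_wf)
  have c: "carr ?D = ?A \<union> ?B" by (simp add: dsum_def)
  have AB: "?A \<inter> ?B = {}" by (auto, presburger)
  have "isom (\<lambda>x. 2*x) P (restr ?D ?A)"
    by (rule isomI[where g="\<lambda>x. x div 2"]) auto
  then have "cposet_iso P (restr ?D ?A)" unfolding cposet_iso_iff by blast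
  moreover have "wf_cposet (restr ?D ?A)" by (rule wf_restr[OF wf]) (unfold c, blast)
  ultimately have A: "restr ?D ?A \<in> F" using F_iso[OF assms(1)] by blast
  have "isom (\<lambda>x. 2*x+1) Q (restr ?D ?B)"
    by (rule isomI[where g="\<lambda>x. x div 2"]) auto
  then have "cposet_iso Q (restr ?D ?B)" unfolding cposet_iso_iff by blast
  moreover have "wf_cposet (restr ?D ?B)" by (rule wf_restr[OF wf]) (unfold c, blast)
  ultimately have B: "restr ?D ?B \<in> F" using F_iso[OF assms(2)] by blast
  have "dunion (restr ?D ?A) (restr ?D ?B) \<in> F"
    using AB by (intro F_dunion A B) simp
  moreover have "isom id (dunion (restr ?D ?A) (restr ?D ?B)) ?D"
    unfolding isom_def by (auto simp: dunion_def bij_betw_def c[simplified])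
  ultimately show ?thesis using wf F_iso by (auto simp: cposet_iso_iff)
qed

text \<open>Every poset of size at most \<open>n\<close> can be relabelled by an initial segment of
  the numbers, and only finitely many orders and colorings live there. The coloring count is where
  the finite color type is used.\<close>

lemma finite_iso_classes:
  "\<exists>S. finite S \<and> S \<subseteq> F \<and> (\<forall>P\<in>F. card (carr P) \<le> n \<longrightarrow> (\<exists>Q\<in>S. cposet_iso Q P))"
proof -
  \<comment> \<open>Colors from \<open>n\<close> on are pinned to \<open>undefined\<close>, so that
    a color map is determined by finitely many values; the records in \<open>N\<close> then embed
    into a finite product.\<close>
  define N :: "'c cposet set" where "N = {P. carr P \<subseteq> {..<n} \<and> (\<forall>x y. lev P x y \<longrightarrow> x < n \<and> y < n)
     \<and> (\<forall>x. n \<le> x \<longrightarrow> colr P x = undefined)}"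
  let ?e = "\<lambda>P :: 'c cposet. (carr P, {(x,y). lev P x y}, colr P)"
  have "inj_on ?e N"
    by (rule inj_onI) (auto simp: fun_eq_iff set_eq_iff intro!: cposet.equality)
  moreover have "?e ` N \<subseteq> Pow {..<n} \<times> Pow ({..<n} \<times> {..<n}) \<times> ({..<n} \<rightarrow>\<^sub>E UNIV)"
  proof (rule image_subsetI)
    fix P assume "P \<in> N"
    then have "carr P \<subseteq> {..<n}" "{(x,y). lev P x y} \<subseteq> {..<n} \<times> {..<n}" "\<And>x. \<not> x < n \<Longrightarrow> colr P x = undefined"
      unfolding N_def mem_Collect_eq by (blast, blast, meson linorder_not_less)
    then show "?e P \<in> Pow {..<n} \<times> Pow ({..<n} \<times> {..<n}) \<times> ({..<n} \<rightarrow>\<^sub>E UNIV)"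
      by (intro SigmaI PowI PiE_I) simp_all
  qed
  moreover have "finite (Pow {..<n} \<times> Pow ({..<n} \<times> {..<n}) \<times> ({..<n} \<rightarrow>\<^sub>E (UNIV :: 'c set)))"
    by (intro finite_cartesian_product finite_PiE) auto
  ultimately have "finite N" by (rule inj_on_finite)
  moreover have "\<exists>Q\<in>N \<inter> F. cposet_iso Q P" if P: "P \<in> F" "card (carr P) \<le> n" for P
  proof -
    obtain g where g: "bij_betw g {0..<card (carr P)} (carr P)"
      using ex_bij_betw_nat_finite[OF F_finite[OF P(1)]] by blast
    let ?k = "card (carr P)"
    define Q where "Q = \<lparr>carr = {0..<?k}, lev = (\<lambda>x y. x < ?k \<and> y < ?k \<and> lev P (g x) (g y)),
        colr = (\<lambda>x. if x < ?k then colr P (g x) else undefined)\<rparr>"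
    have i: "isom g Q P" using g by (auto simp: isom_def Q_def)
    have gi: "g x = g y \<Longrightarrow> x < ?k \<Longrightarrow> y < ?k \<Longrightarrow> x = y" for x y
      using g unfolding bij_betw_def inj_on_def by auto
    have gm: "x < ?k \<Longrightarrow> g x \<in> carr P" for x
      using g unfolding bij_betw_def by auto
    note wfP = wf_cposetD[OF F_wf[OF P(1)]]
    have "wf_cposet Q"
      unfolding wf_cposet_def
    proof (intro conjI allI impI ballI)
      show "finite (carr Q)" by (simp add: Q_def)
      fix x y z
      show "lev Q x y \<Longrightarrow> x \<in> carr Q" "lev Q x y \<Longrightarrow> y \<in> carr Q" by (auto simp: Q_def)
      show "x \<in> carr Q \<Longrightarrow> lev Q x x" by (auto simp: Q_def gm wfP(4))
      show "lev Q x y \<and> lev Q y x \<Longrightarrow> x = y" using gi wfP(5)[of "g x" "g y"] by (auto simp: Q_def)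
      show "lev Q x y \<and> lev Q y z \<Longrightarrow> lev Q x z" using wfP(6)[of "g x" "g y" "g z"] by (auto simp: Q_def)
    qed
    moreover have "cposet_iso Q P" using i by (auto simp: cposet_iso_iff)
    ultimately have "Q \<in> F" using F_iso iso_sym P(1) by blast
    moreover have "Q \<in> N" using P(2) by (auto simp: N_def Q_def)
    ultimately show ?thesis using \<open>cposet_iso Q P\<close> by blast
  qed
  ultimately show ?thesis by (intro exI[of _ "N \<inter> F"]) auto
qed

lemma invD: "f \<in> invariant_funs F \<Longrightarrow> P \<notin> F \<Longrightarrow> f P = 0"
  and inv_iso: "f \<in> invariant_funs F \<Longrightarrow> cposet_iso P Q \<Longrightarrow> P \<in> F \<Longrightarrow> Q \<in> F \<Longrightarrow> f P = f Q"
  unfolding invariant_funs_def by blast+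

lemma invI:
  assumes "\<And>P. P \<notin> F \<Longrightarrow> f P = 0" "\<And>P Q. P \<in> F \<Longrightarrow> Q \<in> F \<Longrightarrow> cposet_iso P Q \<Longrightarrow> f P = f Q"
  shows "f \<in> invariant_funs F"
  using assms unfolding invariant_funs_def by blast

text \<open>By \<open>finite_iso_classes\<close>, finite support on classes amounts to a bound on
  the size of the posets in the support. Such a bound passes through sums, products and the antipode
  more easily than a finite set of representatives.\<close>

lemma Hsp_iff: "f \<in> Hsp F \<longleftrightarrow> f \<in> invariant_funs F \<and> (\<exists>n. \<forall>P. f P \<noteq> 0 \<longrightarrow> card (carr P) \<le> n)"
proof
  assume "f \<in> Hsp F"
  then obtain S where S: "f \<in> invariant_funs F" "finite S" "\<forall>P. f P \<noteq> 0 \<longrightarrow> (\<exists>Q\<in>S. cposet_iso Q P)"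
    unfolding Hsp_def invariant_funs_def by blast
  have "card (carr P) \<le> Max ((\<lambda>P. card (carr P)) ` S)" if "f P \<noteq> 0" for P
  proof -
    obtain Q where "Q \<in> S" "cposet_iso Q P" using S(3) \<open>f P \<noteq> 0\<close> by blast
    then show ?thesis using S(2) iso_card[of Q P] by (metis Max_ge finite_imageI imageI)
  qed
  with S(1) show "f \<in> invariant_funs F \<and> (\<exists>n. \<forall>P. f P \<noteq> 0 \<longrightarrow> card (carr P) \<le> n)" by blast
next
  assume "f \<in> invariant_funs F \<and> (\<exists>n. \<forall>P. f P \<noteq> 0 \<longrightarrow> card (carr P) \<le> n)"
  then obtain n where n: "f \<in> invariant_funs F" "\<forall>P. f P \<noteq> 0 \<longrightarrow> card (carr P) \<le> n" by blast
  obtain S where "finite S" "S \<subseteq> F" "\<forall>P\<in>F. card (carr P) \<le> n \<longrightarrow> (\<exists>Q\<in>S. cposet_iso Q P)"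
    using finite_iso_classes[of n] by blast
  moreover have "f P \<noteq> 0 \<Longrightarrow> P \<in> F" for P using n by (metis invD)
  ultimately show "f \<in> Hsp F"
    using n unfolding Hsp_def invariant_funs_def mem_Collect_eq by (meson subsetD)
qed

lemma Hsp_inv: "f \<in> Hsp F \<Longrightarrow> f \<in> invariant_funs F" by (simp add: Hsp_iff)

lemma Hsp_F: "f \<in> Hsp F \<Longrightarrow> f P \<noteq> 0 \<Longrightarrow> P \<in> F"
  using Hsp_inv invD by blast

lemma Hsp_zero: "fzero \<in> Hsp F"
  unfolding Hsp_iff fzero_def by (auto intro: invI)

lemma Hsp_add:
  assumes "f \<in> Hsp F" "g \<in> Hsp F" shows "fadd f g \<in> Hsp F"
proof -
  obtain m n where "\<forall>P. f P \<noteq> 0 \<longrightarrow> card (carr P) \<le> m" "\<forall>P. g P \<noteq> 0 \<longrightarrow> card (carr P) \<le> n"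
    using assms by (auto simp: Hsp_iff)
  then have "\<forall>P. fadd f g P \<noteq> 0 \<longrightarrow> card (carr P) \<le> max m n"
    by (auto simp: fadd_def) (metis add_0 max.coboundedI1 max.coboundedI2)
  moreover have "fadd f g \<in> invariant_funs F"
    by (rule invI) (simp_all add: fadd_def invD[OF Hsp_inv[OF assms(1)]] invD[OF Hsp_inv[OF assms(2)]]
        inv_iso[OF Hsp_inv[OF assms(1)]] inv_iso[OF Hsp_inv[OF assms(2)]])
  ultimately show ?thesis unfolding Hsp_iff by blast
qed

lemma Hsp_scale: "f \<in> Hsp F \<Longrightarrow> fscale c f \<in> Hsp F"
  unfolding Hsp_iff fscale_def by (auto intro!: invI dest: invD inv_iso)

lemma delta_inv: "delta F P \<in> invariant_funs F"
  by (rule invI) (auto simp: delta_def intro: iso_trans dest: iso_sym)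

lemma delta_Hsp: "delta F P \<in> Hsp F"
proof -
  have "\<forall>Q. delta F P Q \<noteq> 0 \<longrightarrow> card (carr Q) \<le> card (carr P)"
    using iso_card[of P] unfolding delta_def by (metis order_refl)
  thus ?thesis using delta_inv Hsp_iff by blast
qed

lemma unit_Hsp: "unitH F \<in> Hsp F"
  by (simp add: unitH_def delta_Hsp)

lemma unit_apply: "P \<in> F \<Longrightarrow> unitH F P = (if carr P = {} then 1 else 0)"
  by (simp add: unitH_def delta_def)

section \<open>The product\<close>

lemma star_apply: "P \<in> F \<Longrightarrow> star F f g P =
    (\<Sum>I\<in>order_ideals P. f (restr P I) * g (restr P (carr P - I)))"
  by (simp add: star_def)

lemma star_inv:
  assumes f: "f \<in> invariant_funs F" and g: "g \<in> invariant_funs F"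
  shows "star F f g \<in> invariant_funs F"
proof -
  have "star F f g P = star F f g Q" if PQ: "P \<in> F" "Q \<in> F" "isom h P Q" for P Q h
    unfolding star_apply[OF PQ(1)] star_apply[OF PQ(2)]
  proof (rule sum_ideals_isom[OF PQ(3)])
    fix I assume I: "I \<in> order_ideals P"
    note hI = isom_image_ideal[OF PQ(3) I]
    have "isom h (restr P I) (restr Q (h ` I))" using isom_restr[OF PQ(3) ideal_sub[OF I]] .
    then have 1: "f (restr P I) = f (restr Q (h ` I))"
      using PQ I hI by (intro inv_iso[OF f]) (auto simp: cposet_iso_iff)
    have "isom h (restr P (carr P - I)) (restr Q (carr Q - h ` I))"
      unfolding isom_compl[OF PQ(3) ideal_sub[OF I]] by (rule isom_restr[OF PQ(3)]) auto
    then have 2: "g (restr P (carr P - I)) = g (restr Q (carr Q - h ` I))"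
      using PQ I hI by (intro inv_iso[OF g]) (auto simp: cposet_iso_iff)
    show "f (restr P I) * g (restr P (carr P - I)) = f (restr Q (h ` I)) * g (restr Q (carr Q - h ` I))"
      by (simp add: 1 2)
  qed
  thus ?thesis by (intro invI) (auto simp: star_def cposet_iso_iff)
qed

lemma star_nonzeroE:
  assumes "star F f g P \<noteq> 0"
  obtains I where "P \<in> F" "I \<in> order_ideals P" "f (restr P I) \<noteq> 0" "g (restr P (carr P - I)) \<noteq> 0"
proof -
  have P: "P \<in> F" using assms by (auto simp: star_def split: if_splits)
  show ?thesis
  proof (rule ccontr)
    assume "\<not> thesis"
    then have "f (restr P I) * g (restr P (carr P - I)) = 0" if "I \<in> order_ideals P" for I
      using P that \<open>\<And>I. \<lbrakk>P \<in> F; I \<in> order_ideals P; f (restr P I) \<noteq> 0; g (restr P (carr P - I)) \<noteq> 0\<rbrakk> \<Longrightarrow> thesis\<close>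
      by auto
    then have "star F f g P = 0" unfolding star_apply[OF P] by (intro sum.neutral) blast
    with assms show False by simp
  qed
qed

lemma card_ideal_compl: "P \<in> F \<Longrightarrow> I \<in> order_ideals P \<Longrightarrow> card I + card (carr P - I) = card (carr P)"
  by (metis F_finite card_Diff_subset card_mono finite_subset ideal_sub le_add_diff_inverse)

lemma star_Hsp:
  assumes "f \<in> Hsp F" "g \<in> Hsp F" shows "star F f g \<in> Hsp F"
proof -
  obtain m n where mn: "\<forall>P. f P \<noteq> 0 \<longrightarrow> card (carr P) \<le> m" "\<forall>P. g P \<noteq> 0 \<longrightarrow> card (carr P) \<le> n"
    using assms by (auto simp: Hsp_iff)
  have "card (carr P) \<le> m + n" if "star F f g P \<noteq> 0" for P
    using star_nonzeroE[OF that] mn card_ideal_compl by (metis add_mono carr_restr)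
  with assms show ?thesis unfolding Hsp_iff using star_inv by blast
qed

text \<open>Both bracketings are the sum over chains \<open>I\<close> inside \<open>J\<close> of
  \<open>f\<close> on \<open>I\<close>, \<open>g\<close> on \<open>J - I\<close> and
  \<open>h\<close> on the complement of \<open>J\<close>. The identity is therefore purely formal
  and holds for arbitrary functions.\<close>

lemma star_assoc: "star F (star F f g) h = star F f (star F g h)"
proof
  fix P
  show "star F (star F f g) h P = star F f (star F g h) P"
  proof (cases "P \<in> F")
    case True
    have "star F (star F f g) h P = (\<Sum>J\<in>order_ideals P. \<Sum>I\<in>order_ideals (restr P J).
         f (restr P I) * g (restr P (J - I)) * h (restr P (carr P - J)))"
      unfolding star_apply[OF True]
    proof (rule sum.cong[OF refl])
      fix J assume J: "J \<in> order_ideals P"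
      show "star F f g (restr P J) * h (restr P (carr P - J)) = (\<Sum>I\<in>order_ideals (restr P J).
         f (restr P I) * g (restr P (J - I)) * h (restr P (carr P - J)))"
        unfolding star_apply[OF F_ideal[OF True J]] sum_distrib_right
        by (rule sum.cong) (auto dest: ideal_sub)
    qed
    also have "\<dots> = (\<Sum>I\<in>order_ideals P. \<Sum>K\<in>order_ideals (restr P (carr P - I)).
         f (restr P I) * g (restr P ((I \<union> K) - I)) * h (restr P (carr P - (I \<union> K))))"
      by (rule sum_ideal_chains[OF F_finite[OF True]])
    also have "\<dots> = star F f (star F g h) P"
      unfolding star_apply[OF True]
    proof (rule sum.cong[OF refl])
      fix I assume I: "I \<in> order_ideals P"
      show "(\<Sum>K\<in>order_ideals (restr P (carr P - I)).
         f (restr P I) * g (restr P ((I \<union> K) - I)) * h (restr P (carr P - (I \<union> K)))) =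
         f (restr P I) * star F g h (restr P (carr P - I))"
        unfolding star_apply[OF F_compl[OF True I]] sum_distrib_left
      proof (rule sum.cong[OF refl])
        fix K assume "K \<in> order_ideals (restr P (carr P - I))"
        then have "K \<subseteq> carr P - I" using ideal_sub by fastforce
        moreover from this have "(I \<union> K) - I = K" "carr P - I - K = carr P - (I \<union> K)" by auto
        ultimately show "f (restr P I) * g (restr P ((I \<union> K) - I)) * h (restr P (carr P - (I \<union> K))) =
            f (restr P I) * (g (restr (restr P (carr P - I)) K) *
              h (restr (restr P (carr P - I)) (carr (restr P (carr P - I)) - K)))"
          using restr_restr[of "carr P - (I \<union> K)" "carr P - I" P] by (simp add: mult.assoc Diff_mono)
      qed
    qed
    finally show ?thesis .
  qed (simp add: star_def)
qed

lemma star_unit_left: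
  assumes "f \<in> invariant_funs F" shows "star F (unitH F) f = f"
proof
  fix P
  show "star F (unitH F) f P = f P"
  proof (cases "P \<in> F")
    case True
    have "star F (unitH F) f P = (\<Sum>I\<in>order_ideals P. if I = {} then f P else 0)"
      unfolding star_apply[OF True] by (rule sum.cong) (auto simp: True unit_apply)
    then show ?thesis by (simp add: finite_order_ideals F_finite True)
  qed (use invD[OF assms] in \<open>simp add: star_def\<close>)
qed

lemma star_unit_right:
  assumes "f \<in> invariant_funs F" shows "star F f (unitH F) = f"
proof
  fix P
  show "star F f (unitH F) P = f P"
  proof (cases "P \<in> F")
    case True
    have "star F f (unitH F) P = (\<Sum>I\<in>order_ideals P. if I = carr P then f P else 0)"
      unfolding star_apply[OF True] by (rule sum.cong) (auto simp: True unit_apply dest: ideal_sub)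
    then show ?thesis by (simp add: finite_order_ideals F_finite True)
  qed (use invD[OF assms] in \<open>simp add: star_def\<close>)
qed

lemma star_add_left: "star F (fadd f g) h = fadd (star F f h) (star F g h)"
  and star_add_right: "star F h (fadd f g) = fadd (star F h f) (star F h g)"
  by (auto simp: star_def fadd_def fun_eq_iff sum.distrib algebra_simps)

lemma star_scale_left: "star F (fscale c f) g = fscale c (star F f g)"
  and star_scale_right: "star F f (fscale c g) = fscale c (star F f g)"
  by (auto simp: star_def fscale_def fun_eq_iff sum_distrib_left algebra_simps)

section \<open>The coproduct and its compatibility with the product\<close>

lemma cop_apply: "M \<in> F \<Longrightarrow> N \<in> F \<Longrightarrow> cop F f (M, N) = f (dsum M N)"
  by (simp add: cop_def)

lemma cop_outside: "M \<notin> F \<or> N \<notin> F \<Longrightarrow> cop F f (M, N) = 0"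
  by (auto simp: cop_def)

lemma cop_iso:
  assumes "f \<in> invariant_funs F" "cposet_iso M M'" "cposet_iso N N'" "M \<in> F" "M' \<in> F" "N \<in> F" "N' \<in> F"
  shows "cop F f (M, N) = cop F f (M', N')"
  using assms by (auto simp: cop_apply intro!: inv_iso dsum_iso_cong)

lemma cop_inv_left: "f \<in> invariant_funs F \<Longrightarrow> (\<lambda>X. cop F f (X, B)) \<in> invariant_funs F"
  by (cases "B \<in> F") (auto simp: cop_outside intro!: invI cop_iso)

lemma cop_Hsp2:
  assumes "f \<in> Hsp F" shows "cop F f \<in> Hsp2 F"
proof -
  obtain n where n: "\<forall>P. f P \<noteq> 0 \<longrightarrow> card (carr P) \<le> n" using assms by (auto simp: Hsp_iff)
  obtain S where S: "finite S" "S \<subseteq> F" "\<forall>P\<in>F. card (carr P) \<le> n \<longrightarrow> (\<exists>Q\<in>S. cposet_iso Q P)"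
    using finite_iso_classes[of n] by blast
  have "\<exists>(M', N')\<in>S \<times> S. cposet_iso M' M \<and> cposet_iso N' N" if "cop F f (M, N) \<noteq> 0" for M N
  proof -
    have MN: "M \<in> F" "N \<in> F" using that cop_outside by blast+
    then have "f (dsum M N) \<noteq> 0" using that by (simp add: cop_apply)
    then have "card (carr M) + card (carr N) \<le> n"
      using n card_dsum[of M N] F_finite MN by metis
    then obtain M' N' where "M' \<in> S" "N' \<in> S" "cposet_iso M' M" "cposet_iso N' N"
      using S(3) MN by (meson add_leD1 add_leD2)
    then show ?thesis by blast
  qed
  moreover have "finite (S \<times> S)" "S \<times> S \<subseteq> F \<times> F" using S by auto
  ultimately show ?thesis
    unfolding Hsp2_def using cop_iso[OF Hsp_inv[OF assms]] cop_outside by blast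
qed

lemma cop_assoc:
  assumes "f \<in> invariant_funs F" "A \<in> F" "B \<in> F" "C \<in> F"
  shows "cop F f (dsum A B, C) = cop F f (A, dsum B C)"
  using assms by (auto simp: cop_apply intro!: inv_iso dsum_assoc)

lemma cop_counit_left:
  assumes f: "f \<in> invariant_funs F" and "E \<in> F" "carr E = {}" shows "cop F f (E, N) = f N"
  by (cases "N \<in> F") (use assms in \<open>auto simp: cop_apply cop_outside invD[OF f] intro!: inv_iso[OF f] dsum_empty_left F_wf\<close>)

lemma cop_counit_right:
  assumes f: "f \<in> invariant_funs F" and "E \<in> F" "carr E = {}" shows "cop F f (M, E) = f M"
  by (cases "M \<in> F") (use assms in \<open>auto simp: cop_apply cop_outside invD[OF f] intro!: inv_iso[OF f] dsum_empty_right F_wf\<close>)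

lemma cop_comm:
  assumes f: "f \<in> invariant_funs F" shows "cop F f (M, N) = cop F f (N, M)"
  by (cases "M \<in> F \<and> N \<in> F") (auto simp: cop_apply cop_outside intro!: inv_iso[OF f] dsum_comm)

lemma cop_add: "cop F (fadd f g) = fadd (cop F f) (cop F g)"
  and cop_scale: "cop F (fscale c f) = fscale c (cop F f)"
  by (auto simp: cop_def fadd_def fscale_def fun_eq_iff)

lemma cop_star: "cop F (star F f g) = star2 F (cop F f) (cop F g)"
proof (rule ext, clarify)
  fix M N
  show "cop F (star F f g) (M, N) = star2 F (cop F f) (cop F g) (M, N)"
  proof (cases "M \<in> F \<and> N \<in> F")
    case True
    then have "cop F (star F f g) (M, N) =
       (\<Sum>I\<in>order_ideals M. \<Sum>J\<in>order_ideals N. f (dsum (restr M I) (restr N J)) *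
          g (dsum (restr M (carr M - I)) (restr N (carr N - J))))"
      using sum_ideals_dsum[where M=M and N=N and G="\<lambda>A B. f A * g B"] by (simp add: cop_apply star_apply)
    also have "\<dots> = star2 F (cop F f) (cop F g) (M, N)"
      using True by (simp add: star2_def cop_apply)
    finally show ?thesis .
  qed (auto simp: cop_outside star2_def)
qed

lemma cop_unit: "cop F (unitH F) = unit2 F"
proof (rule ext, clarify)
  fix M N
  show "cop F (unitH F) (M, N) = unit2 F (M, N)"
  proof (cases "M \<in> F \<and> N \<in> F")
    case True
    moreover have "carr (dsum M N) = {} \<longleftrightarrow> carr M = {} \<and> carr N = {}" by (simp add: dsum_def)
    ultimately show ?thesis by (simp add: cop_apply unit2_def unit_apply)
  next
    case False
    then show ?thesis using invD[OF Hsp_inv[OF unit_Hsp]] by (auto simp: cop_outside unit2_def)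
  qed
qed

lemma ideals_of_empty: "carr P = {} \<Longrightarrow> order_ideals P = {{}}"
  by (auto simp: order_ideals_def)

lemma counit_star: "counit (star F f g) = counit f * counit g"
  using F_restr_carr[OF F_empty]
  by (simp add: counit_def star_apply ideals_of_empty)

end

section \<open>The antipode\<close>

text \<open>The convolution identity for a left inverse of the identity map, solved for the summand
  of the full ideal. A coproduct is stored as a function of two posets and not as a sum of pure
  tensors, so applying the antipode to its first factor means applying it to the slice
  \<open>\<lambda>X. cop F f (X, B)\<close> for each complement \<open>B\<close>; hence
  \<open>f\<close> changes along the recursion. Replacing the summand of \<open>carr P\<close> by 0
  and asking for a finite carrier make the size decrease.\<close>

function antipode :: "'c cposet set \<Rightarrow> ('c cposet \<Rightarrow> rat) \<Rightarrow> 'c cposet \<Rightarrow> rat" where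
  "antipode F f P = (if finite (carr P) \<and> carr P \<noteq> {}
     then - (\<Sum>I\<in>order_ideals P. if I = carr P then 0
               else antipode F (\<lambda>X. cop F f (X, restr P (carr P - I))) (restr P I))
     else f P)"
  by pat_completeness auto
termination
  by (relation "measure (\<lambda>(F, f, P). card (carr P))")
     (auto intro!: psubset_card_mono dest: ideal_sub)

declare antipode.simps [simp del]

context poset_family
begin

lemma antipode_empty: "carr P = {} \<Longrightarrow> antipode F f P = f P"
  by (simp add: antipode.simps)

lemma antipode_rec:
  assumes "P \<in> F" "carr P \<noteq> {}"
  shows "antipode F f P = - (\<Sum>I\<in>order_ideals P. if I = carr P then 0
               else antipode F (\<lambda>X. cop F f (X, restr P (carr P - I))) (restr P I))"
  using assms F_finite by (subst antipode.simps) simp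

lemma proper_ideal_card: "P \<in> F \<Longrightarrow> I \<in> order_ideals P \<Longrightarrow> I \<noteq> carr P \<Longrightarrow> card I < card (carr P)"
  by (simp add: F_finite ideal_sub psubsetI psubset_card_mono)

lemma antipode_iso:
  assumes "f \<in> invariant_funs F" "P \<in> F" "Q \<in> F" "cposet_iso P Q"
  shows "antipode F f P = antipode F f Q"
  using assms
proof (induction "card (carr P)" arbitrary: f P Q rule: less_induct)
  case less
  note f = less.prems(1) and P = less.prems(2) and Q = less.prems(3)
  obtain h where h: "isom h P Q" using less.prems(4) by (auto simp: cposet_iso_iff)
  have im: "carr Q = h ` carr P" using h by (auto simp: isom_def bij_betw_def)
  show ?case
  proof (cases "carr P = {}")
    case True
    then show ?thesis using im inv_iso[OF f less.prems(4) P Q] by (simp add: antipode_empty)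
  next
    case False
    have inj: "inj_on h (carr P)" using h by (simp add: isom_def bij_betw_def)
    show ?thesis
      unfolding antipode_rec[OF P False] antipode_rec[OF Q, unfolded im, simplified, OF False, folded im]
    proof (rule arg_cong[of _ _ uminus], rule sum_ideals_isom[OF h])
      fix I assume I: "I \<in> order_ideals P"
      note hI = isom_image_ideal[OF h I] and IP = ideal_sub[OF I]
      have eq: "h ` I = carr Q \<longleftrightarrow> I = carr P"
        unfolding im using inj IP by (metis inj_on_image_eq_iff order_refl)
      have i1: "cposet_iso (restr P I) (restr Q (h ` I))"
        using isom_restr[OF h IP] by (auto simp: cposet_iso_iff)
      have "isom h (restr P (carr P - I)) (restr Q (carr Q - h ` I))"
        unfolding isom_compl[OF h IP] by (rule isom_restr[OF h]) auto
      then have i2: "cposet_iso (restr P (carr P - I)) (restr Q (carr Q - h ` I))"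
        by (auto simp: cposet_iso_iff)
      have c: "cop F f (X, restr P (carr P - I)) = cop F f (X, restr Q (carr Q - h ` I))" for X
        by (cases "X \<in> F") (auto simp: cop_outside intro!: cop_iso f i2 F_compl[OF P I] F_compl[OF Q hI])
      show "(if I = carr P then 0 else antipode F (\<lambda>X. cop F f (X, restr P (carr P - I))) (restr P I)) =
         (if h ` I = carr Q then 0
          else antipode F (\<lambda>X. cop F f (X, restr Q (carr Q - h ` I))) (restr Q (h ` I)))"
        using less.hyps[OF _ _ _ _ i1, of "\<lambda>X. cop F f (X, restr Q (carr Q - h ` I))"]
          proper_ideal_card[OF P I] cop_inv_left[OF f] P Q I hI
        by (auto simp: eq c)
    qed
  qed
qed

lemma antipode_add: "antipode F (fadd f g) P = antipode F f P + antipode F g P"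
proof (induction "card (carr P)" arbitrary: f g P rule: less_induct)
  case less
  show ?case
  proof (cases "finite (carr P) \<and> carr P \<noteq> {}")
    case True
    have *: "antipode F (\<lambda>X. cop F (fadd f g) (X, B)) (restr P I)
       = antipode F (\<lambda>X. cop F f (X, B)) (restr P I) + antipode F (\<lambda>X. cop F g (X, B)) (restr P I)"
      if "I \<in> order_ideals P" "I \<noteq> carr P" for I B
    proof -
      have "card (carr (restr P I)) < card (carr P)"
        using that True by (simp add: ideal_sub psubsetI psubset_card_mono)
      from less[OF this, of "\<lambda>X. cop F f (X, B)" "\<lambda>X. cop F g (X, B)"]
      show ?thesis unfolding cop_add by (simp add: fadd_def)
    qed
    have "(\<Sum>I\<in>order_ideals P. if I = carr P then 0
               else antipode F (\<lambda>X. cop F (fadd f g) (X, restr P (carr P - I))) (restr P I)) =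
          (\<Sum>I\<in>order_ideals P. if I = carr P then 0
               else antipode F (\<lambda>X. cop F f (X, restr P (carr P - I))) (restr P I)) +
          (\<Sum>I\<in>order_ideals P. if I = carr P then 0
               else antipode F (\<lambda>X. cop F g (X, restr P (carr P - I))) (restr P I))"
      unfolding sum.distrib[symmetric] by (rule sum.cong) (simp_all add: *)
    then show ?thesis by (subst (1 2 3) antipode.simps) (simp add: True)
  next
    case False
    then show ?thesis by (subst (1 2 3) antipode.simps) (auto simp: fadd_def)
  qed
qed

lemma antipode_scale: "antipode F (fscale c f) P = c * antipode F f P"
proof (induction "card (carr P)" arbitrary: f P rule: less_induct)
  case less
  show ?case
  proof (cases "finite (carr P) \<and> carr P \<noteq> {}")
    case True
    have *: "antipode F (\<lambda>X. cop F (fscale c f) (X, B)) (restr P I)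
       = c * antipode F (\<lambda>X. cop F f (X, B)) (restr P I)"
      if "I \<in> order_ideals P" "I \<noteq> carr P" for I B
    proof -
      have "card (carr (restr P I)) < card (carr P)"
        using that True by (simp add: ideal_sub psubsetI psubset_card_mono)
      from less[OF this, of "\<lambda>X. cop F f (X, B)"]
      show ?thesis unfolding cop_scale by (simp add: fscale_def)
    qed
    have "(\<Sum>I\<in>order_ideals P. if I = carr P then 0
               else antipode F (\<lambda>X. cop F (fscale c f) (X, restr P (carr P - I))) (restr P I)) =
          c * (\<Sum>I\<in>order_ideals P. if I = carr P then 0
               else antipode F (\<lambda>X. cop F f (X, restr P (carr P - I))) (restr P I))"
      unfolding sum_distrib_left by (rule sum.cong) (simp_all add: *)
    then show ?thesis by (subst (1 2) antipode.simps) (simp add: True)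
  next
    case False
    then show ?thesis by (subst (1 2) antipode.simps) (auto simp: fscale_def)
  qed
qed

text \<open>The antipode preserves the degree: passing to a slice lowers it by exactly the size of
  the complement that is cut off. This provides the support bound for membership in
  \<open>Hsp F\<close>.\<close>

lemma antipode_support:
  assumes "P \<in> F" "antipode F f P \<noteq> 0"
  shows "\<exists>Q\<in>F. card (carr Q) = card (carr P) \<and> f Q \<noteq> 0"
  using assms
proof (induction "card (carr P)" arbitrary: f P rule: less_induct)
  case less
  note P = less.prems(1)
  show ?case
  proof (cases "carr P = {}")
    case True
    then show ?thesis using less.prems by (auto simp: antipode_empty intro!: bexI[of _ P])
  next
    case False
    from less.prems(2) have "(\<Sum>I\<in>order_ideals P. if I = carr P then 0
               else antipode F (\<lambda>X. cop F f (X, restr P (carr P - I))) (restr P I)) \<noteq> 0"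
      unfolding antipode_rec[OF P False] by simp
    then obtain I where "I \<in> order_ideals P" "(if I = carr P then 0
               else antipode F (\<lambda>X. cop F f (X, restr P (carr P - I))) (restr P I)) \<noteq> 0"
      by (rule sum.not_neutral_contains_not_neutral)
    then have I: "I \<in> order_ideals P" "I \<noteq> carr P"
      "antipode F (\<lambda>X. cop F f (X, restr P (carr P - I))) (restr P I) \<noteq> 0"
      by (auto split: if_splits)
    from less.hyps[OF _ _ I(3)] proper_ideal_card[OF P I(1,2)] P I(1)
    obtain Q where Q: "Q \<in> F" "card (carr Q) = card I" "cop F f (Q, restr P (carr P - I)) \<noteq> 0" by auto
    let ?D = "dsum Q (restr P (carr P - I))"
    have "card (carr ?D) = card (carr P)"
      using card_ideal_compl[OF P I(1)] Q F_finite P by (subst card_dsum) auto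
    then show ?thesis using Q P I(1) by (intro bexI[of _ ?D]) (auto simp: cop_apply)
  qed
qed

lemma antipode_left:
  assumes P: "P \<in> F" and f: "f \<in> invariant_funs F"
  shows "(\<Sum>I\<in>order_ideals P. antipode F (\<lambda>X. cop F f (X, restr P (carr P - I))) (restr P I))
     = counit f * unitH F P"
proof (cases "carr P = {}")
  case True
  have "restr P {} = P" using F_restr_carr[OF P] True by simp
  with True P show ?thesis
    using inv_iso[OF f, of empty_cposet P] cop_counit_left[OF f P True, of P]
    by (simp add: ideals_of_empty antipode_empty counit_def unit_apply)
next
  case False
  have [simp]: "finite (order_ideals P)" by (simp add: F_finite P finite_order_ideals)
  \<comment> \<open>The slice at the empty complement is \<open>f\<close> itself, so the summand of
    the full ideal is \<open>antipode F f P\<close>.\<close>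
  have "cop F f (X, restr P {}) = f X" for X
    using P by (auto intro!: cop_counit_right f)
  then have "antipode F f P + (\<Sum>I\<in>order_ideals P. if I = carr P then 0
       else antipode F (\<lambda>X. cop F f (X, restr P (carr P - I))) (restr P I))
     = (\<Sum>I\<in>order_ideals P. antipode F (\<lambda>X. cop F f (X, restr P (carr P - I))) (restr P I))"
    using P by (simp add: sum.remove[of "order_ideals P" "carr P"])
  with antipode_rec[OF P False, of f] show ?thesis using P False by (simp add: unit_apply)
qed

text \<open>Both sides unfold to the same sum over chains of two ideals: the left one by the induction hypothesis for
  proper ideals of \<open>P\<close>, the right one by the left recursion for their complements.\<close>

lemma antipode_rec_right:
  assumes "P \<in> F" "carr P \<noteq> {}" "f \<in> invariant_funs F"
  shows "antipode F f P = - (\<Sum>K\<in>order_ideals P. if K = {} then 0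
               else antipode F (\<lambda>Y. cop F f (restr P K, Y)) (restr P (carr P - K)))"
  using assms
proof (induction "card (carr P)" arbitrary: f P rule: less_induct)
  case less
  note P = less.prems(1) and ne = less.prems(2) and f = less.prems(3)
  have fin: "finite (order_ideals P)" by (simp add: F_finite P finite_order_ideals)
  \<comment> \<open>The summand of a chain \<open>K\<close> inside \<open>I\<close>: the antipode
    acts on the middle layer \<open>I - K\<close>, and \<open>f\<close> is evaluated at the sum of
    bottom, middle and top. The zero cases are the terms left out by the two recursions, at
    \<open>I = carr P\<close> and at \<open>K = {}\<close>; the last factor reproduces the value
    zero of \<open>cop\<close> outside \<open>F\<close>.\<close>
  define T where "T K I = (if I = carr P \<or> K = {} then 0 else
     antipode F (\<lambda>Y. f (dsum (restr P K) (dsum Y (restr P (carr P - I))))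
                      * (if Y \<in> F then 1 else 0)) (restr P (I - K)))" for K I
  \<comment> \<open>At \<open>I = {}\<close> the antipode is taken at the empty poset and
    contributes the boundary term \<open>f P\<close>. On the other side the same term arises at
    \<open>K = carr P\<close>, so the boundary terms agree after summation.\<close>
  have left: "(if I = carr P then 0 else antipode F (\<lambda>X. cop F f (X, restr P (carr P - I))) (restr P I))
     = (if I = {} then f P else 0) - (\<Sum>K\<in>order_ideals (restr P I). T K I)"
    if I: "I \<in> order_ideals P" for I
  proof -
    consider "I = carr P" | "I = {}" | "I \<noteq> carr P" "I \<noteq> {}" by blast
    then show ?thesis
    proof cases
      case 1
      then show ?thesis using ne by (simp add: T_def)
    next
      case 2
      have "order_ideals (restr P {}) = {{}}" by (simp add: ideals_of_empty)
      then show ?thesis using 2 ne P cop_counit_left[OF f, of "restr P {}" P]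
        by (simp add: T_def antipode_empty)
    next
      case 3
      let ?B = "restr P (carr P - I)"
      have "antipode F (\<lambda>X. cop F f (X, ?B)) (restr P I)
        = - (\<Sum>K\<in>order_ideals (restr P I). if K = {} then 0
             else antipode F (\<lambda>Y. cop F (\<lambda>X. cop F f (X, ?B)) (restr (restr P I) K, Y))
                  (restr (restr P I) (carr (restr P I) - K)))"
        by (rule less.hyps) (use 3 I P proper_ideal_card cop_inv_left[OF f] in auto)
      also have "\<dots> = - (\<Sum>K\<in>order_ideals (restr P I). T K I)"
      proof (rule arg_cong[of _ _ uminus], rule sum.cong[OF refl])
        fix K assume K: "K \<in> order_ideals (restr P I)"
        then have KI: "K \<subseteq> I" and KP: "K \<in> order_ideals P" using ideals_restr_ideal_iff[OF I] by auto
        have "cop F (\<lambda>X. cop F f (X, ?B)) (restr P K, Y)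
          = f (dsum (restr P K) (dsum Y ?B)) * (if Y \<in> F then 1 else 0)" for Y
          using P KP I by (cases "Y \<in> F")
            (auto simp: cop_apply cop_outside intro!: inv_iso[OF f] dsum_assoc)
        then show "(if K = {} then 0
             else antipode F (\<lambda>Y. cop F (\<lambda>X. cop F f (X, ?B)) (restr (restr P I) K, Y))
                  (restr (restr P I) (carr (restr P I) - K))) = T K I"
          using 3 KI by (simp add: T_def)
      qed
      finally show ?thesis using 3 by simp
    qed
  qed
  have right: "(if K = {} then 0 else antipode F (\<lambda>Y. cop F f (restr P K, Y)) (restr P (carr P - K)))
     = (if K = carr P then f P else 0) - (\<Sum>L\<in>order_ideals (restr P (carr P - K)). T K (K \<union> L))"
    if K: "K \<in> order_ideals P" for K
  proof -
    consider "K = {}" | "K = carr P" | "K \<noteq> carr P" "K \<noteq> {}" by blast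
    then show ?thesis
    proof cases
      case 1
      then show ?thesis using ne by (simp add: T_def)
    next
      case 2
      have "order_ideals (restr P {}) = {{}}" by (simp add: ideals_of_empty)
      then show ?thesis using 2 ne P cop_counit_right[OF f, of "restr P {}" P]
        by (simp add: T_def antipode_empty)
    next
      case 3
      let ?R = "restr P (carr P - K)"
      have "carr ?R \<noteq> {}" using 3 ideal_sub[OF K] by auto
      then have "antipode F (\<lambda>Y. cop F f (restr P K, Y)) ?R
        = - (\<Sum>L\<in>order_ideals ?R. if L = carr ?R then 0
             else antipode F (\<lambda>X. cop F (\<lambda>Y. cop F f (restr P K, Y)) (X, restr ?R (carr ?R - L))) (restr ?R L))"
        using P K by (intro antipode_rec) auto
      also have "\<dots> = - (\<Sum>L\<in>order_ideals ?R. T K (K \<union> L))"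
      proof (rule arg_cong[of _ _ uminus], rule sum.cong[OF refl])
        fix L assume L: "L \<in> order_ideals ?R"
        then have LK: "K \<inter> L = {}" and KL: "K \<union> L \<in> order_ideals P" using ideals_restr_compl_iff[OF K] by auto
        have s: "L \<subseteq> carr P - K" using ideal_sub[OF L] by simp
        have d: "carr P - K - L = carr P - (K \<union> L)" "K \<union> L - K = L" using LK by auto
        have e: "K \<union> L = carr P \<longleftrightarrow> L = carr P - K" using s ideal_sub[OF K] by auto
        have "cop F (\<lambda>Y. cop F f (restr P K, Y)) (X, restr P (carr P - (K \<union> L)))
          = f (dsum (restr P K) (dsum X (restr P (carr P - (K \<union> L))))) * (if X \<in> F then 1 else 0)" for X
          using P K KL by (cases "X \<in> F") (auto simp: cop_apply cop_outside)
        then show "(if L = carr ?R then 0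
             else antipode F (\<lambda>X. cop F (\<lambda>Y. cop F f (restr P K, Y)) (X, restr ?R (carr ?R - L))) (restr ?R L))
             = T K (K \<union> L)"
          using 3 s restr_restr[of "carr P - (K \<union> L)" "carr P - K" P] by (simp add: T_def d e Diff_mono)
      qed
      finally show ?thesis using 3 by simp
    qed
  qed
  have 1: "antipode F f P = - (\<Sum>I\<in>order_ideals P. (if I = {} then f P else 0) - (\<Sum>K\<in>order_ideals (restr P I). T K I))"
    unfolding antipode_rec[OF P ne] using left by (simp cong: sum.cong)
  have 2: "(\<Sum>K\<in>order_ideals P. if K = {} then 0
               else antipode F (\<lambda>Y. cop F f (restr P K, Y)) (restr P (carr P - K)))
     = (\<Sum>K\<in>order_ideals P. (if K = carr P then f P else 0)
          - (\<Sum>L\<in>order_ideals (restr P (carr P - K)). T K (K \<union> L)))"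
    using right by (simp cong: sum.cong)
  show ?case
    unfolding 1 2 sum_subtractf sum_ideal_chains[OF F_finite[OF P]] using fin by simp
qed

lemma antipode_right:
  assumes P: "P \<in> F" and f: "f \<in> invariant_funs F"
  shows "(\<Sum>I\<in>order_ideals P. antipode F (\<lambda>Y. cop F f (restr P I, Y)) (restr P (carr P - I)))
     = counit f * unitH F P"
proof (cases "carr P = {}")
  case True
  have "restr P {} = P" using F_restr_carr[OF P] True by simp
  with True P show ?thesis
    using inv_iso[OF f, of empty_cposet P] cop_counit_left[OF f P True, of P]
    by (simp add: ideals_of_empty antipode_empty counit_def unit_apply)
next
  case False
  have [simp]: "finite (order_ideals P)" by (simp add: F_finite P finite_order_ideals)
  have "cop F f (restr P {}, X) = f X" for X
    using P by (auto intro!: cop_counit_left f)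
  then have "antipode F f P + (\<Sum>K\<in>order_ideals P. if K = {} then 0
               else antipode F (\<lambda>Y. cop F f (restr P K, Y)) (restr P (carr P - K)))
     = (\<Sum>I\<in>order_ideals P. antipode F (\<lambda>Y. cop F f (restr P I, Y)) (restr P (carr P - I)))"
    using P by (simp add: sum.remove[of "order_ideals P" "{}"])
  with antipode_rec_right[OF P False f] show ?thesis using P False by (simp add: unit_apply)
qed

lemma antipode_Hsp:
  assumes "f \<in> Hsp F" shows "(\<lambda>P. if P \<in> F then antipode F f P else 0) \<in> Hsp F"
proof -
  obtain n where "\<forall>P. f P \<noteq> 0 \<longrightarrow> card (carr P) \<le> n" using assms by (auto simp: Hsp_iff)
  then have "\<forall>P. (if P \<in> F then antipode F f P else 0) \<noteq> 0 \<longrightarrow> card (carr P) \<le> n"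
    using antipode_support[of _ f] by (metis (full_types))
  moreover have "(\<lambda>P. if P \<in> F then antipode F f P else 0) \<in> invariant_funs F"
  proof (rule invI)
    fix P Q assume "P \<in> F" "Q \<in> F" "cposet_iso P Q"
    then show "(if P \<in> F then antipode F f P else 0) = (if Q \<in> F then antipode F f Q else 0)"
      using antipode_iso[OF Hsp_inv[OF assms], of P Q] by simp
  qed simp
  ultimately show ?thesis unfolding Hsp_iff by blast
qed

theorem is_hopf_algebra: "hopf_algebra F"
proof -
  let ?S = "\<lambda>f P. if P \<in> F then antipode F f P else 0"
  have S: "(\<forall>f\<in>Hsp F. ?S f \<in> Hsp F)
        \<and> (\<forall>f\<in>Hsp F. \<forall>g\<in>Hsp F. ?S (fadd f g) = fadd (?S f) (?S g))
        \<and> (\<forall>c. \<forall>f\<in>Hsp F. ?S (fscale c f) = fscale c (?S f))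
        \<and> (\<forall>f\<in>Hsp F.
             mult2 F (\<lambda>(A, B). ?S (\<lambda>X. cop F f (X, B)) A) = fscale (counit f) (unitH F)
           \<and> mult2 F (\<lambda>(A, B). ?S (\<lambda>Y. cop F f (A, Y)) B) = fscale (counit f) (unitH F))"
  proof (intro conjI ballI allI)
    fix f assume f: "f \<in> Hsp F"
    show "?S f \<in> Hsp F" by (rule antipode_Hsp[OF f])
    have u: "unitH F P = 0" if "P \<notin> F" for P using that by (simp add: unitH_def delta_def)
    show "mult2 F (\<lambda>(A, B). ?S (\<lambda>X. cop F f (X, B)) A) = fscale (counit f) (unitH F)"
      using antipode_left[OF _ Hsp_inv[OF f]] u
      by (auto simp: mult2_def fscale_def fun_eq_iff cong: sum.cong)
    show "mult2 F (\<lambda>(A, B). ?S (\<lambda>Y. cop F f (A, Y)) B) = fscale (counit f) (unitH F)"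
      using antipode_right[OF _ Hsp_inv[OF f]] u
      by (auto simp: mult2_def fscale_def fun_eq_iff cong: sum.cong)
    fix c
    show "?S (fscale c f) = fscale c (?S f)" using antipode_scale[of c f] by (auto simp: fscale_def)
    fix g
    show "?S (fadd f g) = fadd (?S f) (?S g)" using antipode_add[of f g] by (auto simp: fadd_def)
  qed
  have S': "\<exists>S. (\<forall>f\<in>Hsp F. S f \<in> Hsp F)
        \<and> (\<forall>f\<in>Hsp F. \<forall>g\<in>Hsp F. S (fadd f g) = fadd (S f) (S g))
        \<and> (\<forall>c. \<forall>f\<in>Hsp F. S (fscale c f) = fscale c (S f))
        \<and> (\<forall>f\<in>Hsp F.
             mult2 F (\<lambda>(A, B). S (\<lambda>X. cop F f (X, B)) A) = fscale (counit f) (unitH F)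
           \<and> mult2 F (\<lambda>(A, B). S (\<lambda>Y. cop F f (A, Y)) B) = fscale (counit f) (unitH F))"
    by (rule exI[of _ ?S]) (rule S)
  show ?thesis
    unfolding hopf_algebra_def
    by (intro conjI S' ballI allI;
      (simp add: Hsp_zero Hsp_add Hsp_scale star_Hsp unit_Hsp star_assoc star_unit_left star_unit_right Hsp_inv
       star_add_left star_add_right star_scale_left star_scale_right cop_Hsp2 cop_add cop_scale cop_assoc
       cop_counit_left cop_counit_right cop_star cop_unit counit_star; fail)?;
      simp add: counit_def fadd_def fscale_def unit_apply)
qed

theorem is_cocommutative: "cocommutative F"
  unfolding cocommutative_def using cop_comm Hsp_inv by blast

theorem is_graded_connected: "graded_connected F"
  unfolding graded_connected_def
proof (intro conjI ballI allI impI)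
  fix f assume f: "f \<in> Hsp F"
  then obtain n where "\<forall>P. f P \<noteq> 0 \<longrightarrow> card (carr P) \<le> n" by (auto simp: Hsp_iff)
  then have "degs f \<subseteq> {..n}" by (auto simp: degs_def)
  then show fin: "finite (degs f)" by (rule finite_subset) simp
  show "hproj n f \<in> Hdeg F n" for n
  proof -
    have "hproj n f \<in> invariant_funs F"
    proof (rule invI)
      show "hproj n f P = 0" if "P \<notin> F" for P using invD[OF Hsp_inv[OF f] that] by (simp add: hproj_def)
      show "hproj n f P = hproj n f Q" if "P \<in> F" "Q \<in> F" "cposet_iso P Q" for P Q
        using inv_iso[OF Hsp_inv[OF f] that(3,1,2)] iso_card[OF that(3)] by (simp add: hproj_def)
    qed
    then show ?thesis unfolding Hdeg_def Hsp_iff by (auto simp: hproj_def split: if_splits)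
  qed
  show "f = (\<lambda>P. \<Sum>n\<in>degs f. hproj n f P)"
  proof
    fix P
    have "(\<Sum>n\<in>degs f. hproj n f P) = (\<Sum>n\<in>degs f. if n = card (carr P) then f P else 0)"
      by (rule sum.cong) (auto simp: hproj_def)
    also have "\<dots> = f P" using fin by (auto simp: degs_def)
    finally show "f P = (\<Sum>n\<in>degs f. hproj n f P)" by simp
  qed
next
  fix m n f g assume fg: "f \<in> Hdeg F m \<and> g \<in> Hdeg F n"
  have "card (carr P) = m + n" if nz: "star F f g P \<noteq> 0" for P
  proof -
    obtain I where I: "P \<in> F" "I \<in> order_ideals P" "f (restr P I) \<noteq> 0" "g (restr P (carr P - I)) \<noteq> 0"
      by (rule star_nonzeroE[OF nz])
    then have "card I = m" "card (carr P - I) = n" using fg by (auto simp: Hdeg_def)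
    then show ?thesis using card_ideal_compl[OF I(1,2)] by simp
  qed
  then show "star F f g \<in> Hdeg F (m + n)" using fg star_Hsp by (auto simp: Hdeg_def)
next
  show "unitH F \<in> Hdeg F 0"
    using unit_Hsp by (simp add: Hdeg_def) (simp add: unitH_def delta_def)
next
  fix n f M N assume f: "f \<in> Hdeg F n" and nz: "cop F f (M, N) \<noteq> 0"
  then have MN: "M \<in> F" "N \<in> F" using cop_outside by blast+
  with f nz show "card (carr M) + card (carr N) = n"
    using card_dsum[OF F_finite F_finite, OF MN] by (auto simp: Hdeg_def cop_apply)
next
  fix n f assume "f \<in> Hdeg F n \<and> 0 < n"
  then show "counit f = 0" by (auto simp: Hdeg_def counit_def)
next
  fix f assume f: "f \<in> Hdeg F 0"
  then have fi: "f \<in> invariant_funs F" by (auto simp: Hdeg_def Hsp_inv)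
  have "f P = f empty_cposet * unitH F P" for P
  proof (cases "P \<in> F")
    case True
    then show ?thesis
      using f inv_iso[OF fi, of empty_cposet P] F_finite[OF True] by (auto simp: Hdeg_def unit_apply)
  next
    case False
    then show ?thesis using invD[OF fi] invD[OF Hsp_inv[OF unit_Hsp]] by simp
  qed
  then show "\<exists>c. f = fscale c (unitH F)" by (auto simp: fscale_def)
qed

end

section \<open>Rational function spaces and labelings\<close>

interpretation fn: vector_space "fscale :: rat \<Rightarrow> ('x \<Rightarrow> rat) \<Rightarrow> 'x \<Rightarrow> rat"
  by unfold_locales (auto simp: fscale_def fun_eq_iff algebra_simps)

lemma fadd_eq_plus: "fadd f g = f + g"
  by (simp add: fadd_def fun_eq_iff)

lemma fzero_eq_zero: "fzero = 0"
  by (simp add: fzero_def fun_eq_iff)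

lemma sum_fun_apply: "(\<Sum>t\<in>T. g t) x = (\<Sum>t\<in>T. g t x)"
  by (induction T rule: infinite_finite_induct) auto

lemma rspan_eq_span: "rspan X = fn.span X"
  unfolding rspan_def fn.span_explicit
  by (simp add: fun_eq_iff[of "_ :: _ \<Rightarrow> rat"] sum_fun_apply fscale_def) blast

text \<open>Such a \<open>c\<close> is constant on every component, so the number of its values on
  \<open>P\<close> is a lower bound for the number of components. This is the only form in which
  components are counted.\<close>

definition labeling :: "(nat \<Rightarrow> nat) \<Rightarrow> 'c cposet \<Rightarrow> bool" where
  "labeling c P \<longleftrightarrow> (\<forall>x\<in>carr P. \<forall>y\<in>carr P. lev P x y \<longrightarrow> c x = c y)"

lemma labeling_restr: "labeling c P \<Longrightarrow> S \<subseteq> carr P \<Longrightarrow> labeling c (restr P S)"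
  unfolding labeling_def by auto

lemma labeling_isom:
  assumes "isom h P Q" "labeling c Q"
  shows "labeling (c \<circ> h) P" and "(c \<circ> h) ` carr P = c ` carr Q"
proof -
  have im: "carr Q = h ` carr P" using assms by (auto simp: isom_def bij_betw_def)
  then show "(c \<circ> h) ` carr P = c ` carr Q" by auto
  show "labeling (c \<circ> h) P" using assms unfolding labeling_def isom_def im by auto
qed

lemma connected_labeling:
  assumes "connected_cposet P" "labeling c P" shows "\<exists>v. c ` carr P = {v}"
proof -
  obtain x where x: "x \<in> carr P" using assms by (auto simp: connected_cposet_def)
  let ?A = "{y \<in> carr P. c y = c x}" and ?B = "{y \<in> carr P. c y \<noteq> c x}"
  have "?B = {}"
  proof (rule ccontr)
    assume "?B \<noteq> {}"
    moreover have "?A \<noteq> {}" using x by blast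
    moreover have "?A \<inter> ?B = {}" "?A \<union> ?B = carr P" by auto
    moreover have "\<forall>x\<in>?A. \<forall>y\<in>?B. \<not> lev P x y \<and> \<not> lev P y x"
      using assms(2) unfolding labeling_def by (metis (mono_tags, lifting) mem_Collect_eq)
    ultimately have "\<exists>A B. A \<noteq> {} \<and> B \<noteq> {} \<and> A \<inter> B = {} \<and> A \<union> B = carr P \<and>
            (\<forall>x\<in>A. \<forall>y\<in>B. \<not> lev P x y \<and> \<not> lev P y x)"
      by (intro exI[of _ ?A] exI[of _ ?B] conjI)
    then show False using assms(1) unfolding connected_cposet_def by simp
  qed
  then have "c ` carr P = {c x}" using x by blast
  then show ?thesis by blast
qed

section \<open>Primitive elements\<close>

context poset_family
begin

lemma subspace_Hsp: "fn.subspace (Hsp F)"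
  unfolding fn.subspace_def using Hsp_zero Hsp_add Hsp_scale by (auto simp: fadd_eq_plus fzero_eq_zero)

lemma delta_eq_iff: "P \<in> F \<Longrightarrow> Q \<in> F \<Longrightarrow> delta F P = delta F Q \<longleftrightarrow> cposet_iso P Q"
proof
  assume "P \<in> F" "Q \<in> F" "delta F P = delta F Q"
  then have "delta F P Q = 1" by (simp add: delta_def)
  then show "cposet_iso P Q" by (simp add: delta_def split: if_splits)
next
  assume "cposet_iso P Q"
  then have "cposet_iso P R \<longleftrightarrow> cposet_iso Q R" for R using iso_trans iso_sym by blast
  then show "delta F P = delta F Q" by (simp add: delta_def)
qed

lemma delta_nonzero_iff: "delta F P Q \<noteq> 0 \<longleftrightarrow> Q \<in> F \<and> cposet_iso P Q"
  by (simp add: delta_def)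

text \<open>The generators are confined to the support of \<open>f\<close>, so that information
  about the support turns into membership in a smaller span: for primitives, that of the connected
  indicators; for \<open>delta_span_words\<close>, that of the posets with fewer components.\<close>

lemma Hsp_span_delta:
  assumes f: "f \<in> Hsp F" shows "f \<in> fn.span (delta F ` {Q. f Q \<noteq> 0})"
proof -
  note fi = Hsp_inv[OF f]
  obtain S where S: "finite S" "S \<subseteq> F" "\<forall>P. f P \<noteq> 0 \<longrightarrow> (\<exists>Q\<in>S. cposet_iso Q P)"
    using f unfolding Hsp_def by blast
  define S' where "S' = {Q \<in> S. f Q \<noteq> 0}"
  have S'F: "Q \<in> F" if "Q \<in> S'" for Q using that S by (auto simp: S'_def)
  \<comment> \<open>The sum is indexed by the functions \<open>delta F Q\<close> and not by the
    posets \<open>Q\<close>, so that isomorphic members of \<open>S\<close> are counted once. Any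
    preimage gives the right coefficient because \<open>f\<close> is invariant.\<close>
  define r where "r t = f (inv_into S' (delta F) t)" for t
  have "f P = (\<Sum>t\<in>delta F ` S'. r t * t P)" for P
  proof (cases "P \<in> F")
    case True
    have "(\<Sum>t\<in>delta F ` S'. r t * t P) = (\<Sum>t\<in>delta F ` S'. if t = delta F P then r t else 0)"
    proof (rule sum.cong[OF refl], clarify)
      fix Q assume "Q \<in> S'"
      moreover have "delta F Q P = (if cposet_iso Q P then 1 else 0)" by (simp add: delta_def True)
      ultimately show "r (delta F Q) * delta F Q P = (if delta F Q = delta F P then r (delta F Q) else 0)"
        using True S'F delta_eq_iff[of Q P] by simp
    qed
    also have "\<dots> = (if delta F P \<in> delta F ` S' then r (delta F P) else 0)"
      using S(1) by (simp add: S'_def)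
    also have "\<dots> = f P"
    proof (cases "delta F P \<in> delta F ` S'")
      case True': True
      let ?Q = "inv_into S' (delta F) (delta F P)"
      have "?Q \<in> S'" "delta F ?Q = delta F P"
        using inv_into_into[OF True'] f_inv_into_f[OF True'] by blast+
      then have "cposet_iso ?Q P" "?Q \<in> F" using True S'F delta_eq_iff by blast+
      then have "f ?Q = f P" using True inv_iso[OF fi] by blast
      then show ?thesis using True' by (simp add: r_def)
    next
      case False
      have "f P = 0"
      proof (rule ccontr)
        assume nz: "f P \<noteq> 0"
        then obtain Q where "Q \<in> S" "cposet_iso Q P" using S(3) by blast
        then have "Q \<in> S'" "delta F Q = delta F P"
          using nz S(2) True inv_iso[OF fi, of Q P] delta_eq_iff by (auto simp: S'_def)
        with False show False by (metis imageI)
      qed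
      with False show ?thesis by simp
    qed
    finally show ?thesis by simp
  next
    case False
    then show ?thesis using invD[OF fi False] by (auto simp: delta_def intro!: sum.neutral)
  qed
  then have "f = (\<Sum>t\<in>delta F ` S'. fscale (r t) t)"
    by (simp add: fun_eq_iff sum_fun_apply fscale_def)
  moreover have "\<dots> \<in> fn.span (delta F ` {Q. f Q \<noteq> 0})"
    by (intro fn.span_sum fn.span_scale fn.span_base) (auto simp: S'_def)
  ultimately show ?thesis by simp
qed

definition connected_deltas :: "('c cposet \<Rightarrow> rat) set" where
  "connected_deltas = delta F ` {P \<in> F. connected_cposet P}"

lemma connected_deltas_Hsp: "d \<in> connected_deltas \<Longrightarrow> d \<in> Hsp F"
  by (auto simp: connected_deltas_def delta_Hsp)

lemma connected_delta_labeling: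
  assumes d: "d \<in> connected_deltas" and nz: "d Q \<noteq> 0" and c: "labeling c Q"
  shows "\<exists>v. c ` carr Q = {v}"
proof -
  obtain P h where P: "connected_cposet P" "isom h P Q"
    using d nz unfolding connected_deltas_def by (auto simp: delta_nonzero_iff cposet_iso_iff)
  then show ?thesis using connected_labeling[OF P(1)] labeling_isom[OF P(2) c] by metis
qed

lemma connected_delta_unique:
  assumes "d \<in> connected_deltas" "d Q \<noteq> 0" shows "Q \<in> F" "d = delta F Q"
  using assms delta_eq_iff unfolding connected_deltas_def by (auto simp: delta_nonzero_iff)

lemma primitives_iff: "f \<in> primitives F \<longleftrightarrow> f \<in> Hsp F \<and>
    (\<forall>M\<in>F. \<forall>N\<in>F. f (dsum M N) = f M * unitH F N + unitH F M * f N)"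
proof -
  have "cop F f (M, N) = f M * unitH F N + unitH F M * f N"
    if "f \<in> Hsp F" "M \<notin> F \<or> N \<notin> F" for M N
    using that invD[OF Hsp_inv, of f] invD[OF Hsp_inv[OF unit_Hsp]] by (auto simp: cop_outside)
  then show ?thesis unfolding primitives_def fun_eq_iff using cop_apply by auto metis+
qed

text \<open>Parity is a labeling of \<open>dsum M N\<close> and takes two values when both summands
  are nonempty, whereas a connected poset admits only one. So the coproduct of \<open>d\<close>
  lives on pairs with an empty member.\<close>

lemma connected_delta_primitive:
  assumes d: "d \<in> connected_deltas" shows "d \<in> primitives F"
proof -
  note dH = connected_deltas_Hsp[OF d]
  note di = Hsp_inv[OF dH]
  have ne: "d Q = 0" if "carr Q = {}" for Q
    using connected_delta_labeling[OF d, of Q "\<lambda>_. 0"] that by (auto simp: labeling_def)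
  have "d (dsum M N) = d M * unitH F N + unitH F M * d N" if MN: "M \<in> F" "N \<in> F" for M N
  proof -
    consider "carr N = {}" | "carr M = {}" "carr N \<noteq> {}" | "carr M \<noteq> {}" "carr N \<noteq> {}" by blast
    then show ?thesis
    proof cases
      case 1
      then show ?thesis using MN ne[OF 1] cop_counit_right[OF di MN(2) 1, of M] by (simp add: cop_apply unit_apply)
    next
      case 2
      then show ?thesis using MN cop_counit_left[OF di MN(1) 2(1), of N] by (simp add: cop_apply unit_apply)
    next
      case 3
      obtain x y where "x \<in> carr M" "y \<in> carr N" using 3 by blast
      then have xy: "2 * x \<in> carr (dsum M N)" "2 * y + 1 \<in> carr (dsum M N)" by simp_all
      have l: "labeling (\<lambda>x. x mod 2) (dsum M N)"
        by (auto simp: labeling_def even_iff_mod_2_eq_zero odd_iff_mod_2_eq_one)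
      have "d (dsum M N) = 0"
      proof (rule ccontr)
        assume "d (dsum M N) \<noteq> 0"
        from connected_delta_labeling[OF d this l] obtain v where
          v: "(\<lambda>x. x mod 2) ` carr (dsum M N) = {v}" by blast
        have "(2 * x) mod 2 = v" "(2 * y + 1) mod 2 = v"
          using v xy by blast+
        then show False by simp
      qed
      then show ?thesis using 3 MN by (simp add: unit_apply)
    qed
  qed
  then show ?thesis using dH by (simp add: primitives_iff)
qed

lemma subspace_primitives: "fn.subspace (primitives F)"
proof (rule fn.subspaceI)
  show "0 \<in> primitives F" using fn.subspace_0[OF subspace_Hsp] by (simp add: primitives_iff)
  show "f + g \<in> primitives F" if "f \<in> primitives F" "g \<in> primitives F" for f g
    using that fn.subspace_add[OF subspace_Hsp, of f g] by (simp add: primitives_iff algebra_simps)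
  show "fscale c f \<in> primitives F" if "f \<in> primitives F" for c f
    using that Hsp_scale[of f c] unfolding primitives_iff by (simp add: fscale_def algebra_simps)
qed

text \<open>A separation of \<open>P\<close> into two nonempty parts presents \<open>P\<close> as a
  sum on which the right-hand side of the primitivity equation vanishes.\<close>

lemma primitive_support:
  assumes f: "f \<in> primitives F" and nz: "f P \<noteq> 0" shows "P \<in> F \<and> connected_cposet P"
proof -
  have fH: "f \<in> Hsp F" and fp: "\<And>M N. M \<in> F \<Longrightarrow> N \<in> F \<Longrightarrow> f (dsum M N) = f M * unitH F N + unitH F M * f N"
    using f by (auto simp: primitives_iff)
  note fi = Hsp_inv[OF fH]
  have P: "P \<in> F" using Hsp_F[OF fH nz] .
  have "carr P \<noteq> {}"
  proof
    assume e: "carr P = {}"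
    \<comment> \<open>For the empty poset the primitivity equation reads
      \<open>f P = f P + f P\<close>.\<close>
    have "f (dsum P P) = f P" using cop_counit_left[OF fi P e, of P] P by (simp add: cop_apply)
    with fp[OF P P] nz show False using P e by (simp add: unit_apply)
  qed
  moreover have False if AB: "A \<noteq> {}" "B \<noteq> {}" "A \<inter> B = {}" "A \<union> B = carr P"
      "\<forall>x\<in>A. \<forall>y\<in>B. \<not> lev P x y \<and> \<not> lev P y x" for A B
  proof -
    have "A \<in> order_ideals P" "B \<in> order_ideals P" using AB by (auto simp: order_ideals_def)
    then have F: "restr P A \<in> F" "restr P B \<in> F" using P by auto
    have "cposet_iso (dsum (restr P A) (restr P B)) P"
      using AB by (intro dsum_split F_wf P) auto
    then have "f P = f (dsum (restr P A) (restr P B))" using inv_iso[OF fi] F P by simp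
    also have "\<dots> = 0" using fp[OF F] F AB(1,2) by (simp add: unit_apply)
    finally show False using nz by simp
  qed
  ultimately show ?thesis using P unfolding connected_cposet_def by blast
qed

theorem primitives_eq: "primitives F = fn.span connected_deltas"
proof
  show "fn.span connected_deltas \<subseteq> primitives F"
    by (rule fn.span_minimal[OF _ subspace_primitives]) (auto intro: connected_delta_primitive)
  show "primitives F \<subseteq> fn.span connected_deltas"
  proof
    fix f assume f: "f \<in> primitives F"
    have "delta F ` {Q. f Q \<noteq> 0} \<subseteq> connected_deltas"
      using primitive_support[OF f] unfolding connected_deltas_def by blast
    then have "fn.span (delta F ` {Q. f Q \<noteq> 0}) \<subseteq> fn.span connected_deltas" by (rule fn.span_mono)
    with f show "f \<in> fn.span connected_deltas"
      using Hsp_span_delta[of f] unfolding primitives_iff by blast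
  qed
qed

text \<open>The expansion of (f \<otimes> 1 + 1 \<otimes> f)(g \<otimes> 1 + 1 \<otimes> g). Its two
  mixed terms together are symmetric in \<open>f\<close> and \<open>g\<close>, so they drop out of
  the bracket, which is why the bracket is primitive.\<close>

lemma star_primitives_dsum:
  assumes f: "f \<in> primitives F" and g: "g \<in> primitives F" and MN: "M \<in> F" "N \<in> F"
  shows "star F f g (dsum M N) = star F f g M * unitH F N + f M * g N + g M * f N + unitH F M * star F f g N"
proof -
  let ?u = "unitH F"
  have fi: "f \<in> invariant_funs F" "g \<in> invariant_funs F" "?u \<in> invariant_funs F"
    using f g unit_Hsp Hsp_inv by (auto simp: primitives_iff)
  have tens: "(\<Sum>I\<in>order_ideals M. \<Sum>J\<in>order_ideals N.
     a (restr M I) * b (restr N J) * (p (restr M (carr M - I)) * q (restr N (carr N - J))))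
     = star F a p M * star F b q N" for a b p q
    unfolding star_apply[OF MN(1)] star_apply[OF MN(2)] sum_product
    by (intro sum.cong refl) (simp add: mult_ac)
  have "star F f g (dsum M N) = star2 F (cop F f) (cop F g) (M, N)"
    using cop_star[of f g] MN by (metis cop_apply)
  also have "\<dots> = (\<Sum>I\<in>order_ideals M. \<Sum>J\<in>order_ideals N.
     (f (restr M I) * ?u (restr N J) + ?u (restr M I) * f (restr N J)) *
     (g (restr M (carr M - I)) * ?u (restr N (carr N - J)) + ?u (restr M (carr M - I)) * g (restr N (carr N - J))))"
    using f g MN by (simp add: star2_def cop_apply primitives_iff)
  also have "\<dots> = star F f g M * star F ?u ?u N + star F f ?u M * star F ?u g N
      + star F ?u g M * star F f ?u N + star F ?u ?u M * star F f g N"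
    unfolding tens[symmetric] sum.distrib[symmetric]
    by (intro sum.cong refl) (simp add: algebra_simps)
  finally show ?thesis by (simp add: star_unit_left star_unit_right fi)
qed

theorem bracket_primitive:
  assumes f: "f \<in> primitives F" and g: "g \<in> primitives F" shows "bracket F f g \<in> primitives F"
proof -
  have "bracket F f g \<in> Hsp F"
    using f g unfolding bracket_def primitives_iff by (blast intro: Hsp_add Hsp_scale star_Hsp)
  then show ?thesis unfolding primitives_iff bracket_def
    using star_primitives_dsum[OF f g] star_primitives_dsum[OF g f]
    by (auto simp: fadd_def fscale_def algebra_simps)
qed

section \<open>Products of connected indicator functions\<close>

definition word_prod :: "('c cposet \<Rightarrow> rat) list \<Rightarrow> 'c cposet \<Rightarrow> rat" where
  "word_prod w = foldr (star F) w (unitH F)"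

lemma word_prod_Nil [simp]: "word_prod [] = unitH F"
  and word_prod_Cons [simp]: "word_prod (d # w) = star F d (word_prod w)"
  by (simp_all add: word_prod_def)

lemma word_prod_Hsp: "w \<in> lists connected_deltas \<Longrightarrow> word_prod w \<in> Hsp F"
  by (induction w) (auto intro: unit_Hsp star_Hsp connected_deltas_Hsp)

lemma word_prod_append:
  "v \<in> lists connected_deltas \<Longrightarrow> w \<in> lists connected_deltas \<Longrightarrow> word_prod (v @ w) = star F (word_prod v) (word_prod w)"
  by (induction v) (auto simp: star_assoc star_unit_left Hsp_inv word_prod_Hsp)

text \<open>Rules out cancellation: in \<open>full_glue\<close> a single nonzero summand then shows
  that the whole product does not vanish.\<close>

lemma word_prod_nonneg: "w \<in> lists connected_deltas \<Longrightarrow> 0 \<le> word_prod w P"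
proof (induction w arbitrary: P)
  case Nil
  then show ?case by (simp add: unitH_def delta_def)
next
  case (Cons d w)
  have "0 \<le> d Q" for Q using Cons.prems by (auto simp: connected_deltas_def delta_def)
  then show ?case using Cons by (auto simp: star_def intro!: sum_nonneg)
qed

text \<open>Each letter is evaluated at a connected ideal, which carries one label, so removing that
  ideal loses at most one label. Once the letters are used up some label is left, while the unit
  vanishes on nonempty posets.\<close>

lemma word_prod_vanishes:
  assumes "w \<in> lists connected_deltas" "P \<in> F" "labeling c P" "length w < card (c ` carr P)"
  shows "word_prod w P = 0"
  using assms
proof (induction w arbitrary: P rule: list.induct)
  case Nil
  then show ?case by (auto simp: unit_apply)
next
  case (Cons d w)
  show ?case
  proof (rule ccontr)
    assume "word_prod (d # w) P \<noteq> 0"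
    then obtain I where I: "I \<in> order_ideals P" "d (restr P I) \<noteq> 0" "word_prod w (restr P (carr P - I)) \<noteq> 0"
      by (auto elim: star_nonzeroE)
    obtain v where v: "c ` I = {v}"
      using connected_delta_labeling[of d "restr P I" c] I(2) labeling_restr[OF Cons.prems(3) ideal_sub[OF I(1)]] Cons.prems(1)
      by auto
    have "c ` carr P \<subseteq> insert v (c ` (carr P - I))" using v by blast
    then have "card (c ` carr P) \<le> card (insert v (c ` (carr P - I)))"
      using F_finite[OF Cons.prems(2)] by (intro card_mono) auto
    also have "\<dots> \<le> Suc (card (c ` (carr P - I)))"
      using F_finite[OF Cons.prems(2)] by (simp add: card_insert_if)
    finally have "word_prod w (restr P (carr P - I)) = 0"
      using Cons.prems I by (intro Cons.IH) (auto intro!: labeling_restr)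
    with I(3) show False by simp
  qed
qed

text \<open>With as many labels as letters there is no slack. If the ideal taken by \<open>d\<close>
  were not its whole label class, all labels would survive in the complement, and \<open>w\<close>,
  having one letter too few, would vanish there.\<close>

lemma word_prod_split:
  assumes "d # w \<in> lists connected_deltas" "P \<in> F" "labeling c P" "length (d # w) = card (c ` carr P)"
    and nz: "word_prod (d # w) P \<noteq> 0"
  obtains v A where "v \<in> c ` carr P" "A = {x \<in> carr P. c x = v}" "A \<in> order_ideals P"
    "d (restr P A) \<noteq> 0" "word_prod w (restr P (carr P - A)) \<noteq> 0"
    "c ` (carr P - A) = c ` carr P - {v}" "length w = card (c ` (carr P - A))"
proof -
  obtain I where I: "I \<in> order_ideals P" "d (restr P I) \<noteq> 0" "word_prod w (restr P (carr P - I)) \<noteq> 0"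
    using nz by (auto elim: star_nonzeroE)
  obtain v where v: "c ` I = {v}"
    using connected_delta_labeling[of d "restr P I" c] I(2) labeling_restr[OF assms(3) ideal_sub[OF I(1)]] assms(1)
    by auto
  have IA: "I = {x \<in> carr P. c x = v}"
  proof (rule ccontr)
    assume "I \<noteq> {x \<in> carr P. c x = v}"
    then obtain x where "x \<in> carr P - I" "c x = v" using v ideal_sub[OF I(1)] by blast
    then have "c ` (carr P - I) = c ` carr P" using v by blast
    then have "word_prod w (restr P (carr P - I)) = 0"
      using assms I by (intro word_prod_vanishes[of w _ c]) (auto intro!: labeling_restr)
    with I(3) show False by simp
  qed
  have vP: "v \<in> c ` carr P" using v ideal_sub[OF I(1)] by blast
  have c: "c ` (carr P - I) = c ` carr P - {v}" unfolding IA by auto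
  then have "length w = card (c ` (carr P - I))"
    using assms(4) vP F_finite[OF assms(2)] by simp
  then show thesis using that[OF vP IA I c] by blast
qed

text \<open>Iterating \<open>word_prod_split\<close>, each label class is used up by exactly one
  letter. The right-hand side does not mention \<open>w\<close>, so all words of this length that do
  not vanish at \<open>P\<close> are permutations of each other.\<close>

lemma word_prod_mset:
  assumes "w \<in> lists connected_deltas" "P \<in> F" "labeling c P" "length w = card (c ` carr P)"
    and "word_prod w P \<noteq> 0"
  shows "mset w = image_mset (\<lambda>v. delta F (restr P {x \<in> carr P. c x = v})) (mset_set (c ` carr P))"
  using assms
proof (induction w arbitrary: P rule: list.induct)
  case Nil
  then have "c ` carr P = {}" using F_finite by (metis card_eq_0_iff finite_imageI list.size(3))
  then show ?case by simp
next
  case (Cons d w)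
  from Cons.prems obtain v A where A: "v \<in> c ` carr P" "A = {x \<in> carr P. c x = v}" "A \<in> order_ideals P"
    "d (restr P A) \<noteq> 0" "word_prod w (restr P (carr P - A)) \<noteq> 0"
    "c ` (carr P - A) = c ` carr P - {v}" "length w = card (c ` (carr P - A))"
    by (rule word_prod_split)
  have "mset w = image_mset (\<lambda>u. delta F (restr (restr P (carr P - A)) {x \<in> carr P - A. c x = u}))
       (mset_set (c ` carr P - {v}))"
    using Cons.IH[of "restr P (carr P - A)", unfolded carr_restr A(6)] Cons.prems(1)
      F_compl[OF Cons.prems(2) A(3)] labeling_restr[OF Cons.prems(3) Diff_subset] A(5) A(7)[unfolded A(6)]
    by simp
  also have "\<dots> = image_mset (\<lambda>u. delta F (restr P {x \<in> carr P. c x = u})) (mset_set (c ` carr P - {v}))"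
  proof (rule image_mset_cong)
    fix u assume "u \<in># mset_set (c ` carr P - {v})"
    then have "u \<noteq> v" using F_finite[OF Cons.prems(2)] by simp
    then have "{x \<in> carr P - A. c x = u} = {x \<in> carr P. c x = u}" using A(2) by auto
    moreover from this have "{x \<in> carr P. c x = u} \<subseteq> carr P - A" by blast
    ultimately show "delta F (restr (restr P (carr P - A)) {x \<in> carr P - A. c x = u})
      = delta F (restr P {x \<in> carr P. c x = u})" by simp
  qed
  finally have w: "mset w = image_mset (\<lambda>u. delta F (restr P {x \<in> carr P. c x = u})) (mset_set (c ` carr P - {v}))" .
  have d: "d = delta F (restr P {x \<in> carr P. c x = v})"
    using connected_delta_unique(2)[of d "restr P A"] A Cons.prems by auto
  have "mset_set (c ` carr P) = add_mset v (mset_set (c ` carr P - {v}))"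
    using A(1) F_finite[OF Cons.prems(2)] by (simp add: mset_set.remove)
  then show ?case by (simp add: w d)
qed

text \<open>\<open>full w P\<close> says that \<open>P\<close> has at least as many components as \<open>w\<close> has letters, while the
  product of \<open>w\<close> does not vanish at \<open>P\<close>; then the letters of \<open>w\<close> are the components of \<open>P\<close>.\<close>

definition full :: "('c cposet \<Rightarrow> rat) list \<Rightarrow> 'c cposet \<Rightarrow> bool" where
  "full w P \<longleftrightarrow> w \<in> lists connected_deltas \<and> P \<in> F \<and> word_prod w P \<noteq> 0
     \<and> (\<exists>c. labeling c P \<and> length w = card (c ` carr P))"

lemma full_mset:
  assumes "full w P" "w' \<in> lists connected_deltas" "length w' = length w" "word_prod w' P \<noteq> 0"
  shows "mset w' = mset w"
proof -
  obtain c where "labeling c P" "length w = card (c ` carr P)" using assms(1) by (auto simp: full_def)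
  with assms show ?thesis using word_prod_mset[of w P c] word_prod_mset[of w' P c] by (simp add: full_def)
qed

lemma full_vanishes:
  assumes "full w P" "w' \<in> lists connected_deltas" "length w' < length w"
  shows "word_prod w' P = 0"
  using assms word_prod_vanishes unfolding full_def by metis

lemma full_same_length:
  assumes "full w P" "w' \<in> lists connected_deltas" "length w' = length w" "word_prod w' P \<noteq> 0"
  shows "full w' P"
  using assms unfolding full_def by auto

text \<open>The poset is the disjoint union of the letters. The induction strips the first letter
  from \<open>P\<close> and \<open>Q\<close>; an indicator determines its isomorphism class, and the
  rest of the word stays full on the complements.\<close>

lemma full_unique:
  assumes "full w P" "full w Q" shows "cposet_iso P Q"
  using assms
proof (induction w arbitrary: P Q)
  case Nil
  then have "carr P = {}" "carr Q = {}" by (auto simp: full_def unit_apply split: if_splits)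
  then show ?case using iso_empty_iff iso_sym iso_trans by blast
next
  case (Cons d w)
  have split: "\<exists>A. d (restr R A) \<noteq> 0 \<and> full w (restr R (carr R - A))
      \<and> cposet_iso (dsum (restr R A) (restr R (carr R - A))) R" if full: "full (d # w) R" for R
  proof -
    have R: "d # w \<in> lists connected_deltas" "R \<in> F" "word_prod (d # w) R \<noteq> 0"
      using full by (auto simp: full_def)
    obtain c where c: "labeling c R" "length (d # w) = card (c ` carr R)" using full unfolding full_def by blast
    obtain v A where A: "A = {x \<in> carr R. c x = v}" "A \<in> order_ideals R"
       "d (restr R A) \<noteq> 0" "word_prod w (restr R (carr R - A)) \<noteq> 0" "length w = card (c ` (carr R - A))"
      by (rule word_prod_split[OF R(1,2) c R(3)])
    have "full w (restr R (carr R - A))"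
      unfolding full_def using R A by (auto intro!: exI[of _ c] labeling_restr c)
    moreover have "\<not> lev R x y \<and> \<not> lev R y x" if "x \<in> A" "y \<in> carr R - A" for x y
      using c(1) that unfolding A(1) labeling_def by auto
    then have "cposet_iso (dsum (restr R A) (restr R (carr R - A))) R"
      using ideal_sub[OF A(2)] by (intro dsum_split F_wf R(2)) auto
    ultimately show ?thesis using A(3) by blast
  qed
  obtain A B where A: "d (restr P A) \<noteq> 0" "full w (restr P (carr P - A))"
      "cposet_iso (dsum (restr P A) (restr P (carr P - A))) P"
    and B: "d (restr Q B) \<noteq> 0" "full w (restr Q (carr Q - B))"
      "cposet_iso (dsum (restr Q B) (restr Q (carr Q - B))) Q"
    using split[OF Cons.prems(1)] split[OF Cons.prems(2)] by blast
  have "d \<in> connected_deltas" using Cons.prems by (simp add: full_def)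
  then have "cposet_iso (restr P A) (restr Q B)"
    using connected_delta_unique[of d] A(1) B(1) delta_eq_iff by metis
  then have "cposet_iso (dsum (restr P A) (restr P (carr P - A))) (dsum (restr Q B) (restr Q (carr Q - B)))"
    using Cons.IH[OF A(2) B(2)] by (rule dsum_iso_cong)
  then show ?case using A(3) B(3) iso_sym iso_trans by blast
qed

text \<open>\<open>A\<close> is an ideal with complement \<open>B\<close>, so the product of the two
  nonzero values is one of the nonnegative summands of \<open>word_prod (v @ w) P\<close>.\<close>

lemma full_glue:
  assumes P: "P \<in> F" and AB: "A \<inter> B = {}" "A \<union> B = carr P"
      "\<forall>x\<in>A. \<forall>y\<in>B. \<not> lev P x y \<and> \<not> lev P y x"
    and v: "full v (restr P A)" and w: "full w (restr P B)"
  shows "full (v @ w) P"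
proof -
  obtain a where a: "labeling a (restr P A)" "length v = card (a ` A)" using v by (auto simp: full_def)
  obtain b where b: "labeling b (restr P B)" "length w = card (b ` B)" using w by (auto simp: full_def)
  have vw: "v \<in> lists connected_deltas" "w \<in> lists connected_deltas" using v w by (auto simp: full_def)
  \<comment> \<open>Doubling keeps the labels of \<open>A\<close> and of \<open>B\<close> apart, so
    their numbers add up to the length of \<open>v @ w\<close>.\<close>
  define c where "c x = (if x \<in> A then 2 * a x else 2 * b x + 1)" for x
  have "labeling c P"
    unfolding labeling_def AB(2)[symmetric]
  proof (intro ballI impI)
    fix x y assume xy: "x \<in> A \<union> B" "y \<in> A \<union> B" "lev P x y"
    then have "x \<in> A \<and> y \<in> A \<or> x \<in> B - A \<and> y \<in> B - A" using AB(1,3) by blast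
    then show "c x = c y"
      using xy(3) a(1) b(1) unfolding labeling_def carr_restr lev_restr c_def by auto
  qed
  moreover have "length (v @ w) = card (c ` carr P)"
  proof -
    have B: "B \<subseteq> - A" using AB by auto
    have "c ` carr P = (\<lambda>x. 2 * x) ` a ` A \<union> (\<lambda>x. 2 * x + 1) ` b ` B"
      using B unfolding AB(2)[symmetric] by (auto simp: c_def image_iff)
    moreover have "(\<lambda>x. 2 * x) ` a ` A \<inter> (\<lambda>x. 2 * x + 1) ` b ` B = {}" by (auto, presburger)
    moreover have "finite A" "finite B" using F_finite[OF P] AB(2) by (metis finite_Un)+
    ultimately show ?thesis
      using a(2) b(2) by (simp add: card_Un_disjoint card_image inj_on_def)
  qed
  moreover have "word_prod (v @ w) P \<noteq> 0"
  proof -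
    have A: "A \<in> order_ideals P" using AB by (auto simp: order_ideals_def)
    have B: "carr P - A = B" using AB by auto
    have "0 < word_prod v (restr P A) * word_prod w (restr P (carr P - A))"
      using word_prod_nonneg[OF vw(1), of "restr P A"] word_prod_nonneg[OF vw(2), of "restr P B"] v w
      unfolding B by (auto simp: full_def)
    also have "\<dots> \<le> (\<Sum>I\<in>order_ideals P. word_prod v (restr P I) * word_prod w (restr P (carr P - I)))"
      by (rule member_le_sum[OF A]) (auto simp: word_prod_nonneg vw finite_order_ideals F_finite P)
    also have "\<dots> = word_prod (v @ w) P" by (simp add: word_prod_append vw star_apply P)
    finally show ?thesis by simp
  qed
  ultimately show ?thesis using vw P by (auto simp: full_def)
qed

lemma full_iso:
  assumes "full w P" "cposet_iso P Q" "Q \<in> F" shows "full w Q"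
proof -
  have w: "w \<in> lists connected_deltas" "P \<in> F" "word_prod w P \<noteq> 0" using assms by (auto simp: full_def)
  obtain c where c: "labeling c P" "length w = card (c ` carr P)" using assms by (auto simp: full_def)
  obtain h where h: "isom h Q P" using assms(2) iso_sym cposet_iso_iff by blast
  have "word_prod w Q \<noteq> 0" using inv_iso[OF Hsp_inv[OF word_prod_Hsp[OF w(1)]] assms(2)] w assms(3) by simp
  then show ?thesis using w assms(3) c labeling_isom[OF h c(1)] unfolding full_def by metis
qed

lemma full_Nil: "full [] P" if "P \<in> F" "carr P = {}"
  using that by (auto simp: full_def unit_apply labeling_def)

lemma full_connected:
  assumes "P \<in> F" "connected_cposet P" shows "full [delta F P] P"
proof -
  have "labeling (\<lambda>_. 0) P" by (simp add: labeling_def)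
  moreover have "(\<lambda>_. 0::nat) ` carr P = {0}" using assms(2) by (auto simp: connected_cposet_def)
  moreover have nz: "word_prod [delta F P] P \<noteq> 0"
    using assms by (simp add: star_unit_right delta_inv delta_nonzero_iff)
  ultimately have "\<exists>c. labeling c P \<and> length [delta F P] = card (c ` carr P)"
    by (intro exI[of _ "\<lambda>_. 0::nat"]) simp
  then show ?thesis using assms nz unfolding full_def connected_deltas_def by simp
qed

text \<open>The disjoint sum of the letters is a test poset for the word. These posets are the
  evaluation points that prove independence in \<open>canonical_span_zero\<close>.\<close>

lemma full_ex_poset: "w \<in> lists connected_deltas \<Longrightarrow> \<exists>P. full w P"
proof (induction w)
  case Nil
  show ?case using full_Nil[OF F_empty] by auto
next
  case (Cons d w)
  then obtain Q where Q: "full w Q" by auto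
  then have QF: "Q \<in> F" by (simp add: full_def)
  obtain C where C: "C \<in> F" "connected_cposet C" "d = delta F C"
    using Cons.prems by (auto simp: connected_deltas_def)
  let ?D = "dsum C Q"
  let ?A = "(\<lambda>x. 2*x) ` carr C" and ?B = "(\<lambda>x. 2*x+1) ` carr Q"
  \<comment> \<open>\<open>dsum_restr\<close> describes parts of a sum only as sums, so each half
    appears as a sum with an empty poset, which is then removed up to isomorphism.\<close>
  have A: "restr ?D ?A = dsum C (restr Q {})" using dsum_restr[of "carr C" C "{}" Q] C by simp
  have B: "restr ?D ?B = dsum (restr C {}) Q" using dsum_restr[of "{}" C "carr Q" Q] QF by simp
  have "full [d] (restr ?D ?A)"
    unfolding A C(3) using C QF
    by (intro full_iso[OF full_connected[OF C(1,2)]] iso_sym[OF dsum_empty_right]) (auto intro: F_wf)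
  moreover have "full w (restr ?D ?B)"
    unfolding B using C QF
    by (intro full_iso[OF Q] iso_sym[OF dsum_empty_left]) (auto intro: F_wf)
  ultimately have "full ([d] @ w) ?D"
  proof (rule full_glue[rotated -2])
    show "?A \<inter> ?B = {}" by (auto, presburger)
    show "?A \<union> ?B = carr ?D" by (simp add: dsum_def)
  qed (use C QF in auto)
  then show ?case by auto
qed

text \<open>Repeated bisection reduces to connected posets, and the words of the two parts are
  concatenated by \<open>full_glue\<close>. This takes the place of a decomposition into
  components.\<close>

lemma full_ex_word: "P \<in> F \<Longrightarrow> \<exists>w. full w P"
proof (induction "card (carr P)" arbitrary: P rule: less_induct)
  case less
  note P = less.prems
  show ?case
  proof (cases "carr P = {} \<or> connected_cposet P")
    case True
    then show ?thesis using full_Nil[OF P] full_connected[OF P] by blast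
  next
    case False
    then obtain A B where AB: "A \<noteq> {}" "B \<noteq> {}" "A \<inter> B = {}" "A \<union> B = carr P"
      "\<forall>x\<in>A. \<forall>y\<in>B. \<not> lev P x y \<and> \<not> lev P y x"
      unfolding connected_cposet_def by blast
    have "A \<in> order_ideals P" "B \<in> order_ideals P" using AB by (auto simp: order_ideals_def)
    moreover have "A \<noteq> carr P" "B \<noteq> carr P" using AB by blast+
    ultimately obtain v w where "full v (restr P A)" "full w (restr P B)"
      using less.hyps[of "restr P A"] less.hyps[of "restr P B"] P proper_ideal_card[OF P] by auto
    then show ?thesis using full_glue[OF P AB(3-5)] by blast
  qed
qed

text \<open>Triangularity: \<open>word_prod w\<close> is a nonzero multiple of
  \<open>delta F P\<close> plus indicators of posets on which shorter words are full, and these are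
  covered by the induction hypothesis.\<close>

lemma delta_span_words:
  assumes "full w P" shows "delta F P \<in> fn.span (word_prod ` lists connected_deltas)"
  using assms
proof (induction "length w" arbitrary: w P rule: less_induct)
  case less
  have w: "w \<in> lists connected_deltas" "P \<in> F" "word_prod w P \<noteq> 0" using less.prems by (auto simp: full_def)
  define N where "N = word_prod w P"
  define f where "f = word_prod w - fscale N (delta F P)"
  have "f \<in> Hsp F" unfolding f_def
    by (intro fn.subspace_diff[OF subspace_Hsp] word_prod_Hsp w Hsp_scale delta_Hsp)
  then have "f \<in> fn.span (delta F ` {Q. f Q \<noteq> 0})" by (rule Hsp_span_delta)
  moreover have "delta F ` {Q. f Q \<noteq> 0} \<subseteq> fn.span (word_prod ` lists connected_deltas)"
  proof (clarify)
    fix Q assume nz: "f Q \<noteq> 0"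
    have Q: "Q \<in> F" using Hsp_F[OF \<open>f \<in> Hsp F\<close> nz] .
    then obtain v where v: "full v Q" using full_ex_word by blast
    have not_iso: "\<not> cposet_iso P Q"
    proof
      assume i: "cposet_iso P Q"
      then have "word_prod w Q = N"
        using inv_iso[OF Hsp_inv[OF word_prod_Hsp[OF w(1)]] i] w Q by (simp add: N_def)
      then show False using nz i Q by (simp add: f_def fscale_def delta_def)
    qed
    then have wQ: "word_prod w Q \<noteq> 0" using nz by (auto simp: f_def fscale_def delta_def)
    \<comment> \<open>For equal lengths \<open>w\<close> would be full on \<open>Q\<close> too,
      making \<open>Q\<close> isomorphic to \<open>P\<close>. If \<open>v\<close> were longer,
      \<open>w\<close> would vanish at \<open>Q\<close>. Hence \<open>v\<close> is shorter.\<close>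
    have "length v \<noteq> length w"
      using full_same_length[OF v w(1) _ wQ] full_unique[OF less.prems] not_iso by auto
    moreover have "\<not> length w < length v" using full_vanishes[OF v w(1)] wQ by auto
    ultimately show "delta F Q \<in> fn.span (word_prod ` lists connected_deltas)"
      using less.hyps[OF _ v] by simp
  qed
  ultimately have f: "f \<in> fn.span (word_prod ` lists connected_deltas)"
    using fn.span_minimal[OF _ fn.subspace_span] by blast
  have "delta F P = fscale (1 / N) (word_prod w - f)"
    using w(3) by (simp add: f_def N_def fscale_def fun_eq_iff)
  also have "\<dots> \<in> fn.span (word_prod ` lists connected_deltas)"
    by (intro fn.span_scale fn.span_diff f fn.span_base imageI w)
  finally show ?case .
qed

theorem Hsp_eq_span_words: "Hsp F = fn.span (word_prod ` lists connected_deltas)"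
proof
  show "fn.span (word_prod ` lists connected_deltas) \<subseteq> Hsp F"
    by (rule fn.span_minimal[OF _ subspace_Hsp]) (auto intro: word_prod_Hsp)
  show "Hsp F \<subseteq> fn.span (word_prod ` lists connected_deltas)"
  proof
    fix f assume f: "f \<in> Hsp F"
    have "delta F ` {Q. f Q \<noteq> 0} \<subseteq> fn.span (word_prod ` lists connected_deltas)"
      using Hsp_F[OF f] full_ex_word delta_span_words by blast
    then show "f \<in> fn.span (word_prod ` lists connected_deltas)"
      using Hsp_span_delta[OF f] fn.span_minimal[OF _ fn.subspace_span] by blast
  qed
qed

end

section \<open>The universal property\<close>

locale lie_map = poset_family F for F :: "('c::finite) cposet set" +
  fixes sm :: "rat \<Rightarrow> 'a::ring_1 \<Rightarrow> 'a" and \<phi> :: "('c cposet \<Rightarrow> rat) \<Rightarrow> 'a"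
  assumes alg: "rat_algebra sm"
    and phi_add: "f \<in> primitives F \<Longrightarrow> g \<in> primitives F \<Longrightarrow> \<phi> (fadd f g) = \<phi> f + \<phi> g"
    and phi_scale: "f \<in> primitives F \<Longrightarrow> \<phi> (fscale c f) = sm c (\<phi> f)"
    and phi_bracket: "f \<in> primitives F \<Longrightarrow> g \<in> primitives F \<Longrightarrow> \<phi> (bracket F f g) = \<phi> f * \<phi> g - \<phi> g * \<phi> f"
begin

lemma sm_add: "sm a (x + y) = sm a x + sm a y"
  and sm_add_scalar: "sm (a + b) x = sm a x + sm b x"
  and sm_sm: "sm a (sm b x) = sm (a * b) x"
  and sm_one: "sm 1 x = x"
  and sm_mult_left: "sm a x * y = sm a (x * y)"
  and sm_mult_right: "x * sm a y = sm a (x * y)"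
  using alg unfolding rat_algebra_def by metis+

lemma sm_zero [simp]: "sm 0 x = 0"
  using sm_add_scalar[of 0 0 x] by simp

text \<open>The first factor is the space of all functions and not \<open>Hsp F\<close>: bilinearity
  of \<open>star\<close> holds there too, so the product algebra needs no carrier. The elements that
  matter lie in spans of words.\<close>

definition pair_scale :: "rat \<Rightarrow> ('c cposet \<Rightarrow> rat) \<times> 'a \<Rightarrow> ('c cposet \<Rightarrow> rat) \<times> 'a" where
  "pair_scale c x = (fscale c (fst x), sm c (snd x))"

sublocale pr: vector_space pair_scale
  by unfold_locales
     (auto simp: pair_scale_def sm_add sm_add_scalar sm_sm sm_one fn.scale_right_distrib fn.scale_left_distrib
       prod_eq_iff)

definition pair_mult :: "('c cposet \<Rightarrow> rat) \<times> 'a \<Rightarrow> ('c cposet \<Rightarrow> rat) \<times> 'a \<Rightarrow> ('c cposet \<Rightarrow> rat) \<times> 'a" where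
  "pair_mult x y = (star F (fst x) (fst y), snd x * snd y)"

lemma pair_mult_add_left: "pair_mult (x + y) z = pair_mult x z + pair_mult y z"
  and pair_mult_add_right: "pair_mult z (x + y) = pair_mult z x + pair_mult z y"
  and pair_mult_scale_left: "pair_mult (pair_scale c x) z = pair_scale c (pair_mult x z)"
  and pair_mult_scale_right: "pair_mult z (pair_scale c x) = pair_scale c (pair_mult z x)"
  by (simp_all add: pair_mult_def pair_scale_def prod_eq_iff fadd_eq_plus[symmetric] star_add_left star_add_right
      star_scale_left star_scale_right sm_mult_left sm_mult_right distrib_left distrib_right)

lemma pair_mult_zero_left: "pair_mult 0 z = 0"
  and pair_mult_zero_right: "pair_mult z 0 = 0"
  using pair_mult_scale_left[of 0 0 z] pair_mult_scale_right[of z 0 0] by simp_all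

lemma pair_mult_diff_left: "pair_mult (x - y) z = pair_mult x z - pair_mult y z"
  and pair_mult_diff_right: "pair_mult z (x - y) = pair_mult z x - pair_mult z y"
  using pair_mult_add_left[of "x - y" y z] pair_mult_add_right[of z "x - y" y] by simp_all

section \<open>Words in the product algebra and their length filtration\<close>

definition word_pair :: "('c cposet \<Rightarrow> rat) list \<Rightarrow> ('c cposet \<Rightarrow> rat) \<times> 'a" where
  "word_pair w = (word_prod w, prod_list (map \<phi> w))"

lemma word_pair_append:
  "v \<in> lists connected_deltas \<Longrightarrow> w \<in> lists connected_deltas \<Longrightarrow> word_pair (v @ w) = pair_mult (word_pair v) (word_pair w)"
  by (simp add: word_pair_def pair_mult_def word_prod_append)

lemma word_pair_Cons:
  "d \<in> connected_deltas \<Longrightarrow> w \<in> lists connected_deltas \<Longrightarrow> word_pair (d # w) = pair_mult (word_pair [d]) (word_pair w)"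
  using word_pair_append[of "[d]" w] by simp

lemma word_pair_single: "d \<in> connected_deltas \<Longrightarrow> word_pair [d] = (d, \<phi> d)"
  by (simp add: word_pair_def star_unit_right Hsp_inv connected_deltas_Hsp)

text \<open>The analogue of the standard filtration of an enveloping algebra, carried by the
  subalgebra generated by the pairs of letters and their images.\<close>

definition filtration :: "nat \<Rightarrow> (('c cposet \<Rightarrow> rat) \<times> 'a) set" where
  "filtration k = pr.span (word_pair ` {w \<in> lists connected_deltas. length w \<le> k})"

lemma subspace_filtration: "pr.subspace (filtration k)"
  by (simp add: filtration_def pr.subspace_span)

lemma filtration_mono: "j \<le> k \<Longrightarrow> filtration j \<subseteq> filtration k"
  unfolding filtration_def by (intro pr.span_mono) auto

lemma word_in_filtration: "w \<in> lists connected_deltas \<Longrightarrow> length w \<le> k \<Longrightarrow> word_pair w \<in> filtration k"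
  unfolding filtration_def by (intro pr.span_base) auto

lemma filtration_mult:
  assumes x: "x \<in> filtration j" and y: "y \<in> filtration k" shows "pair_mult x y \<in> filtration (j + k)"
proof -
  have 1: "pair_mult (word_pair v) y \<in> filtration (j + k)" if v: "v \<in> lists connected_deltas" "length v \<le> j" for v
    using y unfolding filtration_def[of k]
  proof (rule pr.span_induct[where P="\<lambda>y. pair_mult (word_pair v) y \<in> filtration (j + k)"])
    show "pr.subspace {y. pair_mult (word_pair v) y \<in> filtration (j + k)}"
      using subspace_filtration[of "j + k"]
      by (auto simp: pr.subspace_def pair_mult_zero_right pair_mult_add_right pair_mult_scale_right)
    show "pair_mult (word_pair v) z \<in> filtration (j + k)"
      if "z \<in> word_pair ` {w \<in> lists connected_deltas. length w \<le> k}" for z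
    proof -
      from that obtain w where w: "z = word_pair w" "w \<in> lists connected_deltas" "length w \<le> k" by blast
      then have "pair_mult (word_pair v) z = word_pair (v @ w)" using v by (simp add: word_pair_append)
      also have "\<dots> \<in> filtration (j + k)" using v w by (intro word_in_filtration) auto
      finally show ?thesis .
    qed
  qed
  show ?thesis
    using x unfolding filtration_def[of j]
  proof (rule pr.span_induct[where P="\<lambda>x. pair_mult x y \<in> filtration (j + k)"])
    show "pr.subspace {x. pair_mult x y \<in> filtration (j + k)}"
      using subspace_filtration[of "j + k"]
      by (auto simp: pr.subspace_def pair_mult_zero_left pair_mult_add_left pair_mult_scale_left)
  qed (use 1 in blast)
qed

text \<open>A bracket of two letters is a combination of letters and in general not a letter.
  Linearity of \<open>\<phi>\<close> extends the case of letters to it; the induction keeps track of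
  primitivity because \<open>\<phi>\<close> is linear only there.\<close>

lemma primitive_in_filtration:
  assumes "g \<in> primitives F" shows "(g, \<phi> g) \<in> filtration 1"
proof -
  have "g \<in> primitives F \<and> (g, \<phi> g) \<in> filtration 1"
    using assms[unfolded primitives_eq]
  proof (rule fn.span_induct)
    show "fn.subspace {g. g \<in> primitives F \<and> (g, \<phi> g) \<in> filtration 1}"
    proof (rule fn.subspaceI; clarify)
      have "\<phi> 0 = 0" using phi_scale[OF fn.subspace_0[OF subspace_primitives], of 0] by simp
      then show "0 \<in> primitives F \<and> (0, \<phi> 0) \<in> filtration 1"
        using fn.subspace_0[OF subspace_primitives] pr.subspace_0[OF subspace_filtration]
        by (simp add: zero_prod_def)
    next
      fix f g assume fg: "f \<in> primitives F" "(f, \<phi> f) \<in> filtration 1" "g \<in> primitives F" "(g, \<phi> g) \<in> filtration 1"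
      then show "f + g \<in> primitives F \<and> (f + g, \<phi> (f + g)) \<in> filtration 1"
        using fn.subspace_add[OF subspace_primitives] pr.subspace_add[OF subspace_filtration fg(2,4)]
          phi_add[OF fg(1,3)] by (simp add: fadd_eq_plus)
    next
      fix c g assume g: "g \<in> primitives F" "(g, \<phi> g) \<in> filtration 1"
      then show "fscale c g \<in> primitives F \<and> (fscale c g, \<phi> (fscale c g)) \<in> filtration 1"
        using fn.subspace_scale[OF subspace_primitives g(1)] pr.subspace_scale[OF subspace_filtration g(2)]
          phi_scale[OF g(1)] by (simp add: pair_scale_def)
    qed
    show "d \<in> primitives F \<and> (d, \<phi> d) \<in> filtration 1" if "d \<in> connected_deltas" for d
      using that connected_delta_primitive[OF that] word_in_filtration[of "[d]" 1] by (simp add: word_pair_single)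
  qed
  then show ?thesis by blast
qed

text \<open>In the first component d e - e d is the bracket by definition, in the second it is the
  image of the bracket because \<open>\<phi>\<close> is a Lie map. The bracket lies in
  \<open>filtration 1\<close>, so one letter is saved.\<close>

lemma word_pair_swap:
  assumes "d \<in> connected_deltas" "e \<in> connected_deltas" "w \<in> lists connected_deltas"
  shows "word_pair (d # e # w) - word_pair (e # d # w) \<in> filtration (Suc (length w))"
proof -
  have p: "d \<in> primitives F" "e \<in> primitives F" using assms connected_delta_primitive by auto
  have "word_pair [d, e] - word_pair [e, d] = (bracket F d e, \<phi> (bracket F d e))"
    using assms p word_pair_Cons[of d "[e]"] word_pair_Cons[of e "[d]"]
    by (simp add: word_pair_single pair_mult_def phi_bracket)
      (simp add: bracket_def fun_eq_iff fadd_def fscale_def)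
  then have "word_pair [d, e] - word_pair [e, d] \<in> filtration 1"
    using primitive_in_filtration[OF bracket_primitive[OF p]] by simp
  from filtration_mult[OF this word_in_filtration[OF assms(3) order_refl]]
  show ?thesis
    using assms word_pair_append[of "[d,e]" w] word_pair_append[of "[e,d]" w] by (simp add: pair_mult_diff_left)
qed

text \<open>Telescoping over the letters of \<open>u\<close>: one exchange at the head, then the
  induction hypothesis multiplied from the left by the letter just passed.\<close>

lemma word_pair_move:
  assumes "d \<in> connected_deltas" "u \<in> lists connected_deltas" "v \<in> lists connected_deltas"
  shows "word_pair (d # u @ v) - word_pair (u @ d # v) \<in> filtration (length (u @ v))"
  using assms
proof (induction u rule: list.induct)
  case Nil
  show ?case using pr.subspace_0[OF subspace_filtration] by simp
next
  case (Cons e u)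
  then have e: "e \<in> connected_deltas" "u @ v \<in> lists connected_deltas" by auto
  have "pair_mult (word_pair [e]) (word_pair (d # u @ v) - word_pair (u @ d # v)) \<in> filtration (1 + length (u @ v))"
    using Cons e by (intro filtration_mult word_in_filtration) auto
  then have "word_pair (e # d # u @ v) - word_pair (e # u @ d # v) \<in> filtration (Suc (length (u @ v)))"
    using Cons.prems e word_pair_Cons[of e "d # u @ v"] word_pair_Cons[of e "u @ d # v"]
    by (simp add: pair_mult_diff_right)
  from pr.subspace_add[OF subspace_filtration word_pair_swap[OF Cons.prems(1) e] this]
  show ?case by simp
qed

lemma word_pair_perm:
  assumes "w \<in> lists connected_deltas" "mset w = mset w'"
  shows "word_pair w - word_pair w' \<in> filtration (length w - 1)"
  using assms
proof (induction w arbitrary: w' rule: list.induct)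
  case Nil
  then show ?case using pr.subspace_0[OF subspace_filtration] by simp
next
  case (Cons d w)
  have "d \<in> set w'" using Cons.prems(2) by (metis list.set_intros(1) mset_eq_setD)
  then obtain u v where w': "w' = u @ d # v" by (meson split_list)
  have m: "mset w = mset (u @ v)" using Cons.prems(2) by (simp add: w')
  have len: "length w = length (u @ v)" using m by (rule mset_eq_length)
  have d: "d \<in> connected_deltas" "w \<in> lists connected_deltas" using Cons.prems by auto
  have uv: "u @ v \<in> lists connected_deltas" using d(2) m by (metis in_lists_conv_set mset_eq_setD)
  have "word_pair (d # w) - word_pair (d # u @ v) \<in> filtration (length w)"
  \<comment> \<open>Subtraction is truncated: \<open>1 + (length w - 1)\<close> is
    \<open>length w\<close> only for nonempty \<open>w\<close>. In the empty case the two words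
    coincide.\<close>
  proof (cases "w = []")
    case True
    then show ?thesis using len pr.subspace_0[OF subspace_filtration] by simp
  next
    case False
    have "pair_mult (word_pair [d]) (word_pair w - word_pair (u @ v)) \<in> filtration (1 + (length w - 1))"
      using Cons.IH[OF d(2) m] d by (intro filtration_mult word_in_filtration) auto
    then show ?thesis using False
      by (simp add: pair_mult_diff_right word_pair_Cons[OF d] word_pair_Cons[OF d(1) uv])
  qed
  moreover have "word_pair (d # u @ v) - word_pair (u @ d # v) \<in> filtration (length w)"
    using word_pair_move[of d u v] d uv len by simp
  ultimately have "word_pair (d # w) - word_pair (u @ d # v) \<in> filtration (length w)"
    using pr.subspace_add[OF subspace_filtration,
      of "word_pair (d # w) - word_pair (d # u @ v)" _ "word_pair (d # u @ v) - word_pair (u @ d # v)"] by simp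
  then show ?case by (simp add: w')
qed

section \<open>Leading terms and injectivity of the first projection\<close>

lemma filtration_vanishes:
  assumes "x \<in> filtration k" "full w P" "k < length w" shows "fst x P = 0"
  using assms(1) unfolding filtration_def
proof (rule pr.span_induct)
  show "pr.subspace {x. fst x P = 0}"
    by (auto simp: pr.subspace_def pair_scale_def fscale_def)
  show "fst y P = 0" if "y \<in> word_pair ` {w \<in> lists connected_deltas. length w \<le> k}" for y
    using that full_vanishes[OF assms(2)] assms(3) unfolding word_pair_def
    by (metis (no_types, lifting) fst_conv imageE le_less_trans mem_Collect_eq)
qed

text \<open>The counterpart of the ordered monomials of Poincare-Birkhoff-Witt. An arbitrary choice
  in each permutation class suffices, so the letters need no order; the choice depends only on the
  multiset.\<close>

definition canonical_word :: "('c cposet \<Rightarrow> rat) list \<Rightarrow> ('c cposet \<Rightarrow> rat) list" where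
  "canonical_word w = (SOME v. mset v = mset w)"

lemma mset_canonical: "mset (canonical_word w) = mset w"
  unfolding canonical_word_def by (rule someI[of _ w]) simp

lemma canonical_eq: "mset v = mset w \<Longrightarrow> canonical_word v = canonical_word w"
  by (simp add: canonical_word_def)

text \<open>By \<open>word_pair_perm\<close> a word of length \<open>Suc k\<close> differs from its
  canonical rearrangement by an element of \<open>filtration k\<close>.\<close>

lemma filtration_Suc_decomp:
  assumes "x \<in> filtration (Suc k)"
  obtains y z where "y \<in> filtration k" "x = y + z"
    "z \<in> pr.span (word_pair ` {w \<in> lists connected_deltas. length w = Suc k \<and> canonical_word w = w})"
proof -
  let ?W = "{w \<in> lists connected_deltas. length w = Suc k \<and> canonical_word w = w}"
  let ?U = "{y + z |y z. y \<in> filtration k \<and> z \<in> pr.span (word_pair ` ?W)}"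
  have sub: "pr.subspace ?U"
    by (rule pr.subspace_sums[OF subspace_filtration pr.subspace_span])
  have "word_pair w \<in> ?U" if w: "w \<in> lists connected_deltas" "length w \<le> Suc k" for w
  proof (cases "length w = Suc k")
    case True
    let ?v = "canonical_word w"
    have m: "mset ?v = mset w" by (rule mset_canonical)
    have "?v \<in> lists connected_deltas" using w(1) m by (metis in_lists_conv_set mset_eq_setD)
    moreover have "length ?v = Suc k" using True m by (metis mset_eq_length)
    ultimately have "?v \<in> ?W" using canonical_eq[OF m] by simp
    then have "word_pair ?v \<in> pr.span (word_pair ` ?W)" by (intro pr.span_base imageI)
    moreover have "word_pair w - word_pair ?v \<in> filtration k"
      using word_pair_perm[OF w(1) m[symmetric]] True by simp
    moreover have "word_pair w = (word_pair w - word_pair ?v) + word_pair ?v" by simp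
    ultimately show ?thesis by blast
  next
    case False
    then have "word_pair w \<in> filtration k" using w by (intro word_in_filtration) auto
    moreover have "word_pair w = word_pair w + 0" by simp
    ultimately show ?thesis using pr.span_zero by blast
  qed
  then have "filtration (Suc k) \<subseteq> ?U"
    unfolding filtration_def[of "Suc k"] by (intro pr.span_minimal[OF _ sub]) blast
  with assms that show thesis by blast
qed

text \<open>At a poset on which \<open>v\<close> is full, a word of the same length survives only if
  it is a permutation of \<open>v\<close>, and among canonical words that is \<open>v\<close> alone.
  So evaluation isolates the coefficient of \<open>v\<close>; the hypothesis concerns first
  components, yet the vanishing coefficients kill both.\<close>

lemma canonical_span_zero:
  assumes z: "z \<in> pr.span (word_pair ` {w \<in> lists connected_deltas. length w = k \<and> canonical_word w = w})"
    and ev: "\<And>w P. full w P \<Longrightarrow> length w = k \<Longrightarrow> fst z P = 0"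
  shows "z = 0"
proof -
  let ?W = "{w \<in> lists connected_deltas. length w = k \<and> canonical_word w = w}"
  obtain T r where T: "finite T" "T \<subseteq> word_pair ` ?W" "z = (\<Sum>t\<in>T. pair_scale (r t) t)"
    using z unfolding pr.span_explicit by blast
  \<comment> \<open>Different words might have the same pair, so one word is chosen for each element
    of \<open>T\<close> before the sum is indexed by words.\<close>
  obtain V where V: "V \<subseteq> ?W" "inj_on word_pair V" "T = word_pair ` V"
    using T(2) by (auto simp: subset_image_inj)
  have finV: "finite V" using T(1) V by (simp add: finite_image_iff)
  have zV: "z = (\<Sum>w\<in>V. pair_scale (r (word_pair w)) (word_pair w))"
    unfolding T(3) V(3) by (rule sum.reindex_cong[OF V(2)]) auto
  have fst_sum: "fst (\<Sum>w\<in>A. g w) = (\<Sum>w\<in>A. fst (g w))" for A and g :: "('c cposet \<Rightarrow> rat) list \<Rightarrow> ('c cposet \<Rightarrow> rat) \<times> 'a"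
    by (induction A rule: infinite_finite_induct) auto
  have "r (word_pair v) = 0" if v: "v \<in> V" for v
  proof -
    have vW: "v \<in> lists connected_deltas" "length v = k" "canonical_word v = v" using v V(1) by auto
    obtain P where P: "full v P" using full_ex_poset[OF vW(1)] by blast
    have "fst z P = (\<Sum>w\<in>V. r (word_pair w) * word_prod w P)"
      unfolding zV fst_sum sum_fun_apply by (simp add: pair_scale_def word_pair_def fscale_def)
    also have "\<dots> = (\<Sum>w\<in>V. if w = v then r (word_pair v) * word_prod v P else 0)"
    proof (rule sum.cong[OF refl])
      fix w assume w: "w \<in> V"
      then have wW: "w \<in> lists connected_deltas" "length w = k" "canonical_word w = w" using V(1) by auto
      have "word_prod w P = 0" if "w \<noteq> v"
        using full_mset[OF P wW(1)] canonical_eq[of w v] vW wW that by auto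
      then show "r (word_pair w) * word_prod w P = (if w = v then r (word_pair v) * word_prod v P else 0)" by simp
    qed
    also have "\<dots> = r (word_pair v) * word_prod v P" using finV v by simp
    finally have "r (word_pair v) * word_prod v P = 0" using ev[OF P vW(2)] by simp
    then show ?thesis using P by (simp add: full_def)
  qed
  then show ?thesis unfolding zV by (intro sum.neutral) simp
qed

text \<open>Every relation among products in \<open>Hsp F\<close> thus holds among the images under
  \<open>\<phi>\<close>. At the posets on which words of length \<open>Suc k\<close> are full the
  lower part vanishes, so the canonical part must be 0 and the element drops to
  \<open>filtration k\<close>. At the bottom, the value at the empty poset reads off the
  scalar.\<close>

lemma filtration_fst_inj: "x \<in> filtration k \<Longrightarrow> fst x = 0 \<Longrightarrow> x = 0"
proof (induction k arbitrary: x)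
  case 0
  have "{w \<in> lists connected_deltas. length w \<le> 0} = {[]}" by auto
  with 0 obtain c where x: "x = pair_scale c (word_pair [])"
    by (auto simp: filtration_def pr.span_singleton)
  have "fst x empty_cposet = c" by (simp add: x pair_scale_def word_pair_def fscale_def unit_apply)
  with 0 show ?case by (simp add: x)
next
  case (Suc k)
  obtain y z where yz: "y \<in> filtration k" "x = y + z"
    "z \<in> pr.span (word_pair ` {w \<in> lists connected_deltas. length w = Suc k \<and> canonical_word w = w})"
    by (rule filtration_Suc_decomp[OF Suc.prems(1)])
  have "z = 0"
  proof (rule canonical_span_zero[OF yz(3)])
    fix w P assume w: "full w P" "length w = Suc k"
    have "fst y P = 0" using filtration_vanishes[OF yz(1) w(1)] w(2) by simp
    moreover have "fst x P = 0" using Suc.prems(2) by simp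
    ultimately show "fst z P = 0" by (simp add: yz(2))
  qed
  then show ?case using Suc yz by simp
qed

section \<open>The extension as a subalgebra that is a graph\<close>

definition graph :: "(('c cposet \<Rightarrow> rat) \<times> 'a) set" where
  "graph = (\<Union>k. filtration k)"

lemma subspace_graph: "pr.subspace graph"
proof (rule pr.subspaceI)
  show "0 \<in> graph" using pr.subspace_0[OF subspace_filtration] by (auto simp: graph_def)
  fix x assume "x \<in> graph"
  then obtain j where j: "x \<in> filtration j" by (auto simp: graph_def)
  then show "pair_scale c x \<in> graph" for c
    using pr.subspace_scale[OF subspace_filtration j] by (auto simp: graph_def)
  fix y assume "y \<in> graph"
  then obtain k where k: "y \<in> filtration k" by (auto simp: graph_def)
  have "x \<in> filtration (max j k)" "y \<in> filtration (max j k)"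
    using j k filtration_mono[of j "max j k"] filtration_mono[of k "max j k"] by auto
  from pr.subspace_add[OF subspace_filtration this] show "x + y \<in> graph" by (auto simp: graph_def)
qed

lemma graph_mult: "x \<in> graph \<Longrightarrow> y \<in> graph \<Longrightarrow> pair_mult x y \<in> graph"
  unfolding graph_def using filtration_mult by blast

lemma graph_unique:
  assumes "(f, a) \<in> graph" "(f, b) \<in> graph" shows "a = b"
proof -
  have "(f, a) - (f, b) \<in> graph" using pr.subspace_diff[OF subspace_graph assms] .
  then obtain k where "(0, a - b) \<in> filtration k" by (auto simp: graph_def)
  from filtration_fst_inj[OF this] show ?thesis by (simp add: zero_prod_def)
qed

lemma graph_total:
  assumes "f \<in> Hsp F" shows "\<exists>a. (f, a) \<in> graph"
  using assms unfolding Hsp_eq_span_words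
proof (rule fn.span_induct)
  show "fn.subspace {f. \<exists>a. (f, a) \<in> graph}"
  proof (rule fn.subspaceI; clarify)
    show "\<exists>a. (0, a) \<in> graph"
      using pr.subspace_0[OF subspace_graph] by (auto simp: zero_prod_def)
    fix f a assume f: "(f, a) \<in> graph"
    show "\<exists>a. (fscale c f, a) \<in> graph" for c
      using pr.subspace_scale[OF subspace_graph f, of c] by (auto simp: pair_scale_def)
    fix g b assume g: "(g, b) \<in> graph"
    show "\<exists>a. (f + g, a) \<in> graph"
      using pr.subspace_add[OF subspace_graph f g] by auto
  qed
  show "\<exists>a. (f, a) \<in> graph" if "f \<in> word_prod ` lists connected_deltas" for f
    using that word_in_filtration unfolding graph_def word_pair_def by blast
qed

lemma extension_exists:
  "\<exists>\<Phi>. (\<forall>f\<in>Hsp F. \<forall>g\<in>Hsp F. \<Phi> (fadd f g) = \<Phi> f + \<Phi> g)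
           \<and> (\<forall>c. \<forall>f\<in>Hsp F. \<Phi> (fscale c f) = sm c (\<Phi> f))
           \<and> (\<forall>f\<in>Hsp F. \<forall>g\<in>Hsp F. \<Phi> (star F f g) = \<Phi> f * \<Phi> g)
           \<and> \<Phi> (unitH F) = 1
           \<and> (\<forall>f\<in>primitives F. \<Phi> f = \<phi> f)"
proof -
  define \<Phi> where "\<Phi> f = (SOME a. (f, a) \<in> graph)" for f
  have G: "(f, \<Phi> f) \<in> graph" if "f \<in> Hsp F" for f
    unfolding \<Phi>_def using someI_ex[OF graph_total[OF that]] .
  have eq: "\<Phi> f = a" if "(f, a) \<in> graph" for f a
    unfolding \<Phi>_def using someI[of "\<lambda>a. (f, a) \<in> graph", OF that] graph_unique that by blast
  show ?thesis
  proof (intro exI[of _ \<Phi>] conjI ballI allI)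
    fix f assume f: "f \<in> Hsp F"
    show "\<Phi> (fscale c f) = sm c (\<Phi> f)" for c
      using eq pr.subspace_scale[OF subspace_graph G[OF f], of c] by (simp add: pair_scale_def)
    fix g assume g: "g \<in> Hsp F"
    show "\<Phi> (fadd f g) = \<Phi> f + \<Phi> g"
      using eq pr.subspace_add[OF subspace_graph G[OF f] G[OF g]] by (simp add: fadd_eq_plus)
    show "\<Phi> (star F f g) = \<Phi> f * \<Phi> g"
      using eq graph_mult[OF G[OF f] G[OF g]] by (simp add: pair_mult_def)
  next
    show "\<Phi> (unitH F) = 1"
      by (rule eq) (use word_in_filtration[of "[]" 0] in \<open>auto simp: graph_def word_pair_def\<close>)
    show "\<Phi> f = \<phi> f" if "f \<in> primitives F" for f
      by (rule eq) (use primitive_in_filtration[OF that] in \<open>auto simp: graph_def\<close>)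
  qed
qed

end

text \<open>The connected indicators are primitive and generate \<open>Hsp F\<close> as an algebra,
  so agreement on them passes to words by multiplicativity and to all of \<open>Hsp F\<close> by
  linearity.\<close>

lemma (in poset_family) extension_unique:
  fixes \<Phi>1 \<Phi>2 :: "('c cposet \<Rightarrow> rat) \<Rightarrow> 'a::ring_1" and sm :: "rat \<Rightarrow> 'a \<Rightarrow> 'a"
  assumes add: "\<And>f g. f \<in> Hsp F \<Longrightarrow> g \<in> Hsp F \<Longrightarrow> \<Phi>1 (fadd f g) = \<Phi>1 f + \<Phi>1 g"
      "\<And>f g. f \<in> Hsp F \<Longrightarrow> g \<in> Hsp F \<Longrightarrow> \<Phi>2 (fadd f g) = \<Phi>2 f + \<Phi>2 g"
    and scale: "\<And>c f. f \<in> Hsp F \<Longrightarrow> \<Phi>1 (fscale c f) = sm c (\<Phi>1 f)"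
      "\<And>c f. f \<in> Hsp F \<Longrightarrow> \<Phi>2 (fscale c f) = sm c (\<Phi>2 f)"
    and mult: "\<And>f g. f \<in> Hsp F \<Longrightarrow> g \<in> Hsp F \<Longrightarrow> \<Phi>1 (star F f g) = \<Phi>1 f * \<Phi>1 g"
      "\<And>f g. f \<in> Hsp F \<Longrightarrow> g \<in> Hsp F \<Longrightarrow> \<Phi>2 (star F f g) = \<Phi>2 f * \<Phi>2 g"
    and unit: "\<Phi>1 (unitH F) = 1" "\<Phi>2 (unitH F) = 1"
    and agree: "\<And>f. f \<in> primitives F \<Longrightarrow> \<Phi>1 f = \<Phi>2 f"
    and f: "f \<in> Hsp F"
  shows "\<Phi>1 f = \<Phi>2 f"
proof -
  \<comment> \<open>Membership in \<open>Hsp F\<close> is carried through the induction because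
    additivity and scaling are assumed only there.\<close>
  have "f \<in> Hsp F \<and> \<Phi>1 f = \<Phi>2 f"
    using f[unfolded Hsp_eq_span_words]
  proof (rule fn.span_induct)
    note H0 = fn.subspace_0[OF subspace_Hsp]
    show "fn.subspace {f. f \<in> Hsp F \<and> \<Phi>1 f = \<Phi>2 f}"
    proof (rule fn.subspaceI; clarify)
      have "\<Phi>1 0 = 0" "\<Phi>2 0 = 0" using add(1)[OF H0 H0] add(2)[OF H0 H0] by (simp_all add: fadd_eq_plus)
      then show "0 \<in> Hsp F \<and> \<Phi>1 0 = \<Phi>2 0" using H0 by simp
    next
      fix f g assume "f \<in> Hsp F" "\<Phi>1 f = \<Phi>2 f" "g \<in> Hsp F" "\<Phi>1 g = \<Phi>2 g"
      then show "f + g \<in> Hsp F \<and> \<Phi>1 (f + g) = \<Phi>2 (f + g)"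
        using add[of f g] Hsp_add[of f g] by (simp add: fadd_eq_plus)
    next
      fix c f assume "f \<in> Hsp F" "\<Phi>1 f = \<Phi>2 f"
      then show "fscale c f \<in> Hsp F \<and> \<Phi>1 (fscale c f) = \<Phi>2 (fscale c f)"
        using scale[of f c] Hsp_scale[of f c] by simp
    qed
    have "\<Phi>1 (word_prod w) = \<Phi>2 (word_prod w)" if "w \<in> lists connected_deltas" for w
      using that
      by (induction w) (auto simp: unit mult connected_deltas_Hsp word_prod_Hsp agree connected_delta_primitive)
    then show "g \<in> Hsp F \<and> \<Phi>1 g = \<Phi>2 g" if "g \<in> word_prod ` lists connected_deltas" for g
      using that word_prod_Hsp by auto
  qed
  then show ?thesis by simp
qed

theorem (in poset_family) universal_property:
  fixes sm :: "rat \<Rightarrow> 'a::ring_1 \<Rightarrow> 'a"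
  assumes "rat_algebra sm" shows "uea_property F (primitives F) sm"
  unfolding uea_property_def
proof (intro allI impI, elim conjE, intro conjI allI impI ballI)
  fix \<phi> :: "('c cposet \<Rightarrow> rat) \<Rightarrow> 'a"
  assume "\<forall>f\<in>primitives F. \<forall>g\<in>primitives F. \<phi> (fadd f g) = \<phi> f + \<phi> g"
    and "\<forall>c. \<forall>f\<in>primitives F. \<phi> (fscale c f) = sm c (\<phi> f)"
    and "\<forall>f\<in>primitives F. \<forall>g\<in>primitives F. \<phi> (bracket F f g) = \<phi> f * \<phi> g - \<phi> g * \<phi> f"
  then interpret lie_map F sm \<phi>
    using assms by unfold_locales auto
  show "\<exists>\<Phi>. (\<forall>f\<in>Hsp F. \<forall>g\<in>Hsp F. \<Phi> (fadd f g) = \<Phi> f + \<Phi> g)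
           \<and> (\<forall>c. \<forall>f\<in>Hsp F. \<Phi> (fscale c f) = sm c (\<Phi> f))
           \<and> (\<forall>f\<in>Hsp F. \<forall>g\<in>Hsp F. \<Phi> (star F f g) = \<Phi> f * \<Phi> g)
           \<and> \<Phi> (unitH F) = 1
           \<and> (\<forall>f\<in>primitives F. \<Phi> f = \<phi> f)"
    by (rule extension_exists)
qed (elim conjE, rule extension_unique, simp_all)

theorem mainTheorem2:
  fixes F :: "('c::finite) cposet set"
  assumes "family_ok F"
  shows "hopf_algebra F \<and> graded_connected F \<and> cocommutative F
     \<and> (\<forall>f\<in>primitives F. \<forall>g\<in>primitives F. bracket F f g \<in> primitives F)
     \<and> primitives F = rspan (delta F ` {P \<in> F. connected_cposet P})
     \<and> (\<forall>sm :: rat \<Rightarrow> 'a::ring_1 \<Rightarrow> 'a. rat_algebra sm \<longrightarrow> uea_property F (primitives F) sm)"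
proof -
  interpret poset_family F by unfold_locales (rule assms)
  have "primitives F = rspan (delta F ` {P \<in> F. connected_cposet P})"
    unfolding primitives_eq connected_deltas_def rspan_eq_span ..
  then show ?thesis
    by (intro conjI ballI allI impI is_hopf_algebra is_graded_connected is_cocommutative bracket_primitive universal_property)
qed

end
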